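(* Let $J\neq F_n^\infty$ be an arbitrary WOT-closed two-sided ideal of $F_n^\infty$, let $S_1,\ldots,S_n$ be the left creation operators on the full Fock space $F^2(H_n)$, and let $B_i:=P_{\mathcal N_J}S_i|_{\mathcal N_J}$, $i=1,\ldots,n$. Then $[B_1,\ldots,B_n]$ is the maximal $J$-constrained piece of $[S_1,\ldots,S_n]$.
   Context: Let $n\in\{1,2,\dots\}$ and let $F^2(H_n)=\bigoplus_{k\ge 0}H_n^{\otimes k}$ be the full Fock space of an $n$-dimensional complex Hilbert space $H_n$ with orthonormal basis $e_1,\dots,e_n$ (with $H_n^{\otimes 0}=\mathbb C1$); $S_i\varphi=e_i\otimes\varphi$. $F_n^\infty\subset B(F^2(H_n))$ is the WOT-closed algebra generated by $S_1,\dots,S_n$ and the identity. Put $\mathcal N_J=F^2(H_n)\ominus\overline{JF^2(H_n)}$. $\mathbb F_n^+$ is the free semigroup on $g_1,\dots,g_n$, $|\alpha|$ the length of a word, and $T_\alpha=T_{i_1}\cdots T_{i_k}$, $e_\alpha=e_{i_1}\otimes\cdots\otimes e_{i_k}$ for $\alpha=g_{i_1}\cdots g_{i_k}$. Functional calculus: if $\varphi\in F_n^\infty$ with $\varphi(1)=\sum_\alpha a_\alpha e_\alpha$, and $T=[T_1,\dots,T_n]$ is a completely non-coisometric row contraction (i.e. $\sum_iT_iT_i^*\le I$ and there is no $h\neq0$ with $\sum_{|\alpha|=k}\|T_\alpha^*h\|^2=\|h\|^2$ for all $k\ge1$; every compression of $[S_1,\dots,S_n]$ to a co-invariant subspace is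 such), then $\varphi(T_1,\dots,T_n)=\text{SOT-}\lim_{r\to1}\sum_{k\ge0}\sum_{|\alpha|=k}r^{|\alpha|}a_\alpha T_\alpha$. Let $T=[T_1,\dots,T_n]$, $T_i\in B(\mathcal H)$, be a completely non-coisometric row contraction and $\mathcal C\subset F_n^\infty$. Let $\mathcal M_{\mathcal C}$ be the closed span of all subspaces $\mathcal M\subseteq\mathcal H$ co-invariant under $T_1,\dots,T_n$ (i.e. $T_i^*\mathcal M\subseteq\mathcal M$) such that $\varphi(P_{\mathcal M}T_1|_{\mathcal M},\dots,P_{\mathcal M}T_n|_{\mathcal M})=0$ for all $\varphi\in\mathcal C$. The row contraction $[P_{\mathcal M_{\mathcal C}}T_1|_{\mathcal M_{\mathcal C}},\dots,P_{\mathcal M_{\mathcal C}}T_n|_{\mathcal M_{\mathcal C}}]$ is called the maximal $\mathcal C$-constrained piece of $[T_1,\dots,T_n]$. *)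

theory Defs
  imports "HOL-Analysis.Analysis"
begin

section \<open>Complex Hilbert spaces\<close>

text \<open>
  The real inner product of the library is kept as the real part of the complex one, so that
  norm and topology are inherited from \<^class>\<open>real_inner\<close>. The complex inner product is linear in
  its first argument.
\<close>

class complex_inner = real_inner +
  fixes scaleC :: "complex \<Rightarrow> 'a \<Rightarrow> 'a" (infixr "*\<^sub>C" 75)
    and cinner :: "'a \<Rightarrow> 'a \<Rightarrow> complex"
  assumes scaleC_add_right: "a *\<^sub>C (x + y) = a *\<^sub>C x + a *\<^sub>C y"
    and scaleC_add_left: "(a + b) *\<^sub>C x = a *\<^sub>C x + b *\<^sub>C x"
    and scaleC_scaleC: "a *\<^sub>C b *\<^sub>C x = (a * b) *\<^sub>C x"
    and scaleR_scaleC: "r *\<^sub>R x = complex_of_real r *\<^sub>C x"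
    and cinner_commute: "cinner x y = cnj (cinner y x)"
    and cinner_add_left: "cinner (x + y) z = cinner x z + cinner y z"
    and cinner_scaleC_left: "cinner (a *\<^sub>C x) y = a * cinner x y"
    and Re_cinner: "Re (cinner x y) = inner x y"

class chilbert_space = complex_inner + complete_space

definition closed_csubspace :: "'a::chilbert_space set \<Rightarrow> bool" where
  "closed_csubspace M \<longleftrightarrow> closed M \<and> 0 \<in> M \<and> (\<forall>x\<in>M. \<forall>y\<in>M. x + y \<in> M) \<and> (\<forall>c. \<forall>x\<in>M. c *\<^sub>C x \<in> M)"

definition closed_cspan :: "'a::chilbert_space set \<Rightarrow> 'a set" where
  "closed_cspan A = closed_csubspace hull A"

definition orth_compl :: "'a::chilbert_space set \<Rightarrow> 'a set" where
  "orth_compl M = {x. \<forall>y\<in>M. cinner x y = 0}"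

definition orth_proj :: "'a::chilbert_space set \<Rightarrow> 'a \<Rightarrow> 'a" where
  "orth_proj M x = (THE y. y \<in> M \<and> x - y \<in> orth_compl M)"

definition bounded_clinear :: "('a::chilbert_space \<Rightarrow> 'a) \<Rightarrow> bool" where
  "bounded_clinear T \<longleftrightarrow> bounded_linear T \<and> (\<forall>c x. T (c *\<^sub>C x) = c *\<^sub>C T x)"

definition cadjoint :: "('a::chilbert_space \<Rightarrow> 'a) \<Rightarrow> 'a \<Rightarrow> 'a" where
  "cadjoint T = (THE G. \<forall>x y. cinner (T x) y = cinner x (G y))"

text \<open>The weak operator topology; its \<^const>\<open>topspace\<close> is the set of all bounded operators.\<close>

definition wot :: "('a::chilbert_space \<Rightarrow> 'a) topology" where
  "wot = topology_generated_by {{T. bounded_clinear T \<and> cinner (T x) y \<in> U} | x y U. open U}"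

definition operator_algebra :: "('a::chilbert_space \<Rightarrow> 'a) set \<Rightarrow> bool" where
  "operator_algebra A \<longleftrightarrow>
     A \<subseteq> {T. bounded_clinear T} \<and> (\<lambda>x. 0) \<in> A \<and>
     (\<forall>S\<in>A. \<forall>T\<in>A. (\<lambda>x. S x + T x) \<in> A) \<and>
     (\<forall>c. \<forall>T\<in>A. (\<lambda>x. c *\<^sub>C T x) \<in> A) \<and>
     (\<forall>S\<in>A. \<forall>T\<in>A. S \<circ> T \<in> A)"

definition wot_closed_algebra_generated :: "('a::chilbert_space \<Rightarrow> 'a) set \<Rightarrow> ('a \<Rightarrow> 'a) set" where
  "wot_closed_algebra_generated G = (\<lambda>A. operator_algebra A \<and> closedin wot A) hull G"

definition two_sided_ideal :: "('a::chilbert_space \<Rightarrow> 'a) set \<Rightarrow> ('a \<Rightarrow> 'a) set \<Rightarrow> bool" where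
  "two_sided_ideal A J \<longleftrightarrow>
     J \<subseteq> A \<and> (\<lambda>x. 0) \<in> J \<and>
     (\<forall>S\<in>J. \<forall>T\<in>J. (\<lambda>x. S x + T x) \<in> J) \<and>
     (\<forall>c. \<forall>T\<in>J. (\<lambda>x. c *\<^sub>C T x) \<in> J) \<and>
     (\<forall>S\<in>A. \<forall>T\<in>J. S \<circ> T \<in> J \<and> T \<circ> S \<in> J)"


section \<open>Square-summable families\<close>

lemma abs_summable_mult_of_square_summable:
  fixes f g :: "'i \<Rightarrow> complex"
  assumes "(\<lambda>i. (cmod (f i))\<^sup>2) summable_on UNIV" "(\<lambda>i. (cmod (g i))\<^sup>2) summable_on UNIV"
  shows "(\<lambda>i. cmod (f i) * cmod (g i)) summable_on UNIV"
proof (rule summable_on_comparison_test)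
  show "(\<lambda>i. (cmod (f i))\<^sup>2 + (cmod (g i))\<^sup>2) summable_on UNIV"
    using assms by (rule summable_on_add)
  show "cmod (f i) * cmod (g i) \<le> (cmod (f i))\<^sup>2 + (cmod (g i))\<^sup>2" for i
  proof -
    have "0 \<le> (cmod (f i) - cmod (g i))\<^sup>2" by simp
    then have "2 * (cmod (f i) * cmod (g i)) \<le> (cmod (f i))\<^sup>2 + (cmod (g i))\<^sup>2"
      by (simp add: power2_eq_square algebra_simps)
    moreover have "0 \<le> cmod (f i) * cmod (g i)" by simp
    ultimately show ?thesis by linarith
  qed
qed simp

lemma summable_mult_cnj_of_square_summable:
  fixes f g :: "'i \<Rightarrow> complex"
  assumes "(\<lambda>i. (cmod (f i))\<^sup>2) summable_on UNIV" "(\<lambda>i. (cmod (g i))\<^sup>2) summable_on UNIV"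
  shows "(\<lambda>i. f i * cnj (g i)) summable_on UNIV"
  by (rule abs_summable_summable)
    (use abs_summable_mult_of_square_summable[OF assms] in \<open>simp add: norm_mult\<close>)

lemma square_summable_add:
  fixes f g :: "'i \<Rightarrow> complex"
  assumes "(\<lambda>i. (cmod (f i))\<^sup>2) summable_on UNIV" "(\<lambda>i. (cmod (g i))\<^sup>2) summable_on UNIV"
  shows "(\<lambda>i. (cmod (f i + g i))\<^sup>2) summable_on UNIV"
proof (rule summable_on_comparison_test)
  show "(\<lambda>i. ((cmod (f i))\<^sup>2 + (cmod (g i))\<^sup>2) + 2 * (cmod (f i) * cmod (g i))) summable_on UNIV"
    by (intro summable_on_add summable_on_cmult_right abs_summable_mult_of_square_summable assms)
  show "(cmod (f i + g i))\<^sup>2 \<le> ((cmod (f i))\<^sup>2 + (cmod (g i))\<^sup>2) + 2 * (cmod (f i) * cmod (g i))" for i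
  proof -
    have "(cmod (f i + g i))\<^sup>2 \<le> (cmod (f i) + cmod (g i))\<^sup>2"
      by (intro power_mono norm_triangle_ineq) simp
    then show ?thesis by (simp add: power2_eq_square algebra_simps)
  qed
qed simp

lemma square_summable_scale:
  fixes f :: "'i \<Rightarrow> complex"
  assumes "(\<lambda>i. (cmod (f i))\<^sup>2) summable_on UNIV"
  shows "(\<lambda>i. (cmod (c * f i))\<^sup>2) summable_on UNIV"
  using summable_on_cmult_right[OF assms, of "(cmod c)\<^sup>2"]
  by (simp add: norm_mult power_mult_distrib)

typedef 'i ell2 = "{f :: 'i \<Rightarrow> complex. (\<lambda>i. (cmod (f i))\<^sup>2) summable_on UNIV}"
  morphisms coord Abs_ell2
  by (rule exI[of _ "\<lambda>_. 0"]) simp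

setup_lifting type_definition_ell2

instantiation ell2 :: (type) real_normed_vector
begin

lift_definition zero_ell2 :: "'a ell2" is "\<lambda>_. 0" by simp
lift_definition plus_ell2 :: "'a ell2 \<Rightarrow> 'a ell2 \<Rightarrow> 'a ell2" is "\<lambda>f g i. f i + g i"
  by (rule square_summable_add)
lift_definition uminus_ell2 :: "'a ell2 \<Rightarrow> 'a ell2" is "\<lambda>f i. - f i" by simp
lift_definition minus_ell2 :: "'a ell2 \<Rightarrow> 'a ell2 \<Rightarrow> 'a ell2" is "\<lambda>f g i. f i - g i"
  subgoal for f g using square_summable_add[of f "\<lambda>i. - g i"] by simp done
lift_definition scaleR_ell2 :: "real \<Rightarrow> 'a ell2 \<Rightarrow> 'a ell2" is "\<lambda>r f i. complex_of_real r * f i"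
  by (rule square_summable_scale)

definition norm_ell2 :: "'a ell2 \<Rightarrow> real" where
  "norm x = sqrt (\<Sum>\<^sub>\<infinity>i. (cmod (coord x i))\<^sup>2)"
definition sgn_ell2 :: "'a ell2 \<Rightarrow> 'a ell2" where "sgn (x :: 'a ell2) = inverse (norm x) *\<^sub>R x"
definition dist_ell2 :: "'a ell2 \<Rightarrow> 'a ell2 \<Rightarrow> real" where
  "dist (x :: 'a ell2) y = norm (x - y)"
definition uniformity_ell2 :: "('a ell2 \<times> 'a ell2) filter" where
  "uniformity = (INF e\<in>{0<..}. principal {(x, y :: 'a ell2). dist x y < e})"
definition open_ell2 :: "'a ell2 set \<Rightarrow> bool" where
  "open (U :: 'a ell2 set) = (\<forall>x\<in>U. \<forall>\<^sub>F (x', y) in uniformity. x' = x \<longrightarrow> y \<in> U)"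

lemma coord_summable: "(\<lambda>i. (cmod (coord x i))\<^sup>2) summable_on UNIV"
  using coord[of x] by simp

lemma norm_ell2_square: "(norm x)\<^sup>2 = (\<Sum>\<^sub>\<infinity>i. (cmod (coord x i))\<^sup>2)" for x :: "'a ell2"
  by (simp add: norm_ell2_def infsum_nonneg)

lemma norm_ell2_nonneg: "0 \<le> norm x" for x :: "'a ell2"
  by (simp add: norm_ell2_def infsum_nonneg)

lemma sum_coord_le_norm:
  fixes x :: "'a ell2"
  assumes "finite F"
  shows "(\<Sum>i\<in>F. (cmod (coord x i))\<^sup>2) \<le> (norm x)\<^sup>2"
  unfolding norm_ell2_square using assms by (intro finite_sum_le_infsum) (auto simp: coord_summable)

instance
proof
  fix x y z :: "'a ell2" and a b r :: real
  show "x + y + z = x + (y + z)" "x + y = y + x" "0 + x = x" "- x + x = 0" "x - y = x + - y"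
    by (transfer; simp add: algebra_simps fun_eq_iff)+
  show "a *\<^sub>R (x + y) = a *\<^sub>R x + a *\<^sub>R y" "(a + b) *\<^sub>R x = a *\<^sub>R x + b *\<^sub>R x"
    "a *\<^sub>R b *\<^sub>R x = (a * b) *\<^sub>R x" "1 *\<^sub>R x = x"
    by (transfer; simp add: algebra_simps fun_eq_iff)+
  show "sgn x = inverse (norm x) *\<^sub>R x" by (rule sgn_ell2_def)
  show "dist x y = norm (x - y)" by (rule dist_ell2_def)
  show "uniformity = (INF e\<in>{0<..}. principal {(x, y :: 'a ell2). dist x y < e})"
    by (rule uniformity_ell2_def)
  show "open U = (\<forall>x\<in>U. \<forall>\<^sub>F (x', y) in uniformity. x' = x \<longrightarrow> y \<in> U)" for U :: "'a ell2 set"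
    by (rule open_ell2_def)
  show "norm x = 0 \<longleftrightarrow> x = 0"
  proof
    assume "norm x = 0"
    then have "(\<Sum>\<^sub>\<infinity>i. (cmod (coord x i))\<^sup>2) = 0"
      by (simp add: norm_ell2_square[symmetric])
    then have "(cmod (coord x i))\<^sup>2 = 0" for i
      by (intro nonneg_infsum_le_0D[where f = "\<lambda>i. (cmod (coord x i))\<^sup>2" and A = UNIV])
        (auto simp: coord_summable)
    then show "x = 0" by (simp add: coord_inject[symmetric] zero_ell2.rep_eq fun_eq_iff)
  qed (simp add: norm_ell2_def zero_ell2.rep_eq)
  show "norm (a *\<^sub>R x) = \<bar>a\<bar> * norm x"
    by (simp add: norm_ell2_def scaleR_ell2.rep_eq norm_mult power_mult_distrib
        infsum_cmult_right coord_summable real_sqrt_mult)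
  show "norm (x + y) \<le> norm x + norm y"
  proof -
    have le: "L2_set (\<lambda>i. cmod (coord u i)) F \<le> norm u" if "finite F" for u :: "'a ell2" and F
      unfolding L2_set_def using sum_coord_le_norm[OF that, of u]
      by (intro real_le_lsqrt) (auto simp: norm_ell2_nonneg sum_nonneg)
    have "(\<Sum>\<^sub>\<infinity>i. (cmod (coord (x + y) i))\<^sup>2) \<le> (norm x + norm y)\<^sup>2"
    proof (rule infsum_le_finite_sums[OF coord_summable])
      fix F :: "'a set" assume F: "finite F"
      have "L2_set (\<lambda>i. cmod (coord (x + y) i)) F
              \<le> L2_set (\<lambda>i. cmod (coord x i) + cmod (coord y i)) F"
        by (intro L2_set_mono) (auto simp: plus_ell2.rep_eq norm_triangle_ineq)
      also have "\<dots> \<le> norm x + norm y"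
        by (rule order_trans[OF L2_set_triangle_ineq add_mono[OF le[OF F, of x] le[OF F, of y]]])
      finally show "(\<Sum>i\<in>F. (cmod (coord (x + y) i))\<^sup>2) \<le> (norm x + norm y)\<^sup>2"
        unfolding L2_set_def by (rule sqrt_le_D)
    qed
    then have "(norm (x + y))\<^sup>2 \<le> (norm x + norm y)\<^sup>2"
      by (simp only: norm_ell2_square)
    then show ?thesis
      by (rule power2_le_imp_le) (simp add: norm_ell2_nonneg)
  qed
qed

end

lemma coord_le_norm: "cmod (coord x i) \<le> norm x"
  using sum_coord_le_norm[of "{i}" x] by (simp add: power2_le_iff_abs_le)

lemma coord_mult_summable: "(\<lambda>i. coord x i * cnj (coord y i)) summable_on UNIV"
  by (intro summable_mult_cnj_of_square_summable coord_summable)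

instantiation ell2 :: (type) real_inner
begin

definition inner_ell2 :: "'a ell2 \<Rightarrow> 'a ell2 \<Rightarrow> real" where
  "inner x y = Re (\<Sum>\<^sub>\<infinity>i. coord x i * cnj (coord y i))"

lemma inner_ell2_self: "inner x x = (norm x)\<^sup>2" for x :: "'a ell2"
proof -
  have "inner x x = (\<Sum>\<^sub>\<infinity>i. Re (coord x i * cnj (coord x i)))"
    unfolding inner_ell2_def by (rule infsum_Re[symmetric, OF coord_mult_summable])
  also have "\<dots> = (\<Sum>\<^sub>\<infinity>i. (cmod (coord x i))\<^sup>2)"
    by (intro infsum_cong) (simp add: cmod_power2, simp add: power2_eq_square)
  finally show ?thesis by (simp add: norm_ell2_square)
qed

instance
proof
  fix x y z :: "'a ell2" and r :: real
  have "(\<Sum>\<^sub>\<infinity>i. coord y i * cnj (coord x i)) = cnj (\<Sum>\<^sub>\<infinity>i. coord x i * cnj (coord y i))"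
    by (subst infsum_cnj[symmetric]) (simp add: mult.commute)
  then show "inner x y = inner y x"
    by (simp add: inner_ell2_def)
  show "inner (x + y) z = inner x z + inner y z"
    unfolding inner_ell2_def plus_ell2.rep_eq
    by (simp add: distrib_right infsum_add coord_mult_summable)
  show "inner (r *\<^sub>R x) y = r * inner x y"
    unfolding inner_ell2_def scaleR_ell2.rep_eq
    by (simp add: mult.assoc infsum_cmult_right coord_mult_summable)
  show "0 \<le> inner x x" "inner x x = 0 \<longleftrightarrow> x = 0" "norm x = sqrt (inner x x)"
    by (simp_all add: inner_ell2_self)
qed

end

instantiation ell2 :: (type) complex_inner
begin

lift_definition scaleC_ell2 :: "complex \<Rightarrow> 'a ell2 \<Rightarrow> 'a ell2" is "\<lambda>c f i. c * f i"
  by (rule square_summable_scale)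

definition cinner_ell2 :: "'a ell2 \<Rightarrow> 'a ell2 \<Rightarrow> complex" where
  "cinner x y = (\<Sum>\<^sub>\<infinity>i. coord x i * cnj (coord y i))"

instance
proof
  fix x y z :: "'a ell2" and a b :: complex and r :: real
  show "a *\<^sub>C (x + y) = a *\<^sub>C x + a *\<^sub>C y" "(a + b) *\<^sub>C x = a *\<^sub>C x + b *\<^sub>C x"
    "a *\<^sub>C b *\<^sub>C x = (a * b) *\<^sub>C x" "r *\<^sub>R x = complex_of_real r *\<^sub>C x"
    by (transfer; simp add: algebra_simps fun_eq_iff)+
  show "cinner x y = cnj (cinner y x)"
    unfolding cinner_ell2_def by (subst infsum_cnj[symmetric]) (simp add: mult.commute)
  show "cinner (x + y) z = cinner x z + cinner y z"
    unfolding cinner_ell2_def plus_ell2.rep_eq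
    by (simp add: distrib_right infsum_add coord_mult_summable)
  show "cinner (a *\<^sub>C x) y = a * cinner x y"
    unfolding cinner_ell2_def scaleC_ell2.rep_eq
    by (simp add: mult.assoc infsum_cmult_right coord_mult_summable)
  show "Re (cinner x y) = inner x y"
    by (simp add: cinner_ell2_def inner_ell2_def)
qed

end

instance ell2 :: (type) chilbert_space
proof
  fix X :: "nat \<Rightarrow> 'a ell2"
  assume X: "Cauchy X"
  define f where "f i = lim (\<lambda>n. coord (X n) i)" for i
  have f: "(\<lambda>n. coord (X n) i) \<longlonglongrightarrow> f i" for i
  proof -
    have "Cauchy (\<lambda>n. coord (X n) i)"
    proof (rule metric_CauchyI)
      fix e :: real assume "0 < e"
      then obtain N where N: "\<And>m n. m \<ge> N \<Longrightarrow> n \<ge> N \<Longrightarrow> dist (X m) (X n) < e"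
        using metric_CauchyD[OF X \<open>0 < e\<close>] by auto
      have "dist (coord (X m) i) (coord (X n) i) \<le> dist (X m) (X n)" for m n
        using coord_le_norm[of "X m - X n" i] by (simp add: dist_norm minus_ell2.rep_eq)
      then show "\<exists>N. \<forall>m\<ge>N. \<forall>n\<ge>N. dist (coord (X m) i) (coord (X n) i) < e"
        using N by (meson le_less_trans)
    qed
    then show ?thesis
      unfolding f_def by (simp add: Cauchy_convergent_iff convergent_LIMSEQ_iff)
  qed
  have bound: "\<exists>N. \<forall>m\<ge>N. \<forall>F. finite F \<longrightarrow> (\<Sum>i\<in>F. (cmod (coord (X m) i - f i))\<^sup>2) \<le> e\<^sup>2"
    if "e > 0" for e
  proof -
    obtain N where N: "\<And>m n. m \<ge> N \<Longrightarrow> n \<ge> N \<Longrightarrow> dist (X m) (X n) < e"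
      using metric_CauchyD[OF X \<open>e > 0\<close>] by auto
    have "(\<Sum>i\<in>F. (cmod (coord (X m) i - f i))\<^sup>2) \<le> e\<^sup>2" if "m \<ge> N" "finite F" for m F
    proof (rule LIMSEQ_le_const2)
      show "(\<lambda>n. \<Sum>i\<in>F. (cmod (coord (X m) i - coord (X n) i))\<^sup>2)
              \<longlonglongrightarrow> (\<Sum>i\<in>F. (cmod (coord (X m) i - f i))\<^sup>2)"
        by (intro tendsto_intros f)
      have "(\<Sum>i\<in>F. (cmod (coord (X m) i - coord (X n) i))\<^sup>2) \<le> e\<^sup>2" if "n \<ge> N" for n
      proof -
        have "(\<Sum>i\<in>F. (cmod (coord (X m) i - coord (X n) i))\<^sup>2) \<le> (norm (X m - X n))\<^sup>2"
          using sum_coord_le_norm[OF \<open>finite F\<close>, of "X m - X n"] by (simp add: minus_ell2.rep_eq)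
        also have "\<dots> \<le> e\<^sup>2"
          using N[OF \<open>m \<ge> N\<close> \<open>n \<ge> N\<close>] by (intro power_mono) (auto simp: dist_norm)
        finally show ?thesis .
      qed
      then show "\<exists>N. \<forall>n\<ge>N. (\<Sum>i\<in>F. (cmod (coord (X m) i - coord (X n) i))\<^sup>2) \<le> e\<^sup>2"
        by blast
    qed
    then show ?thesis by blast
  qed
  have diff: "(\<lambda>i. (cmod (coord (X m) i - f i))\<^sup>2) summable_on UNIV"
    if "\<forall>F. finite F \<longrightarrow> (\<Sum>i\<in>F. (cmod (coord (X m) i - f i))\<^sup>2) \<le> e\<^sup>2" for m and e :: real
    using that by (intro nonneg_bdd_above_summable_on) (auto simp: bdd_above_def)
  have "(\<lambda>i. (cmod (f i))\<^sup>2) summable_on UNIV"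
  proof -
    obtain m where m: "\<forall>F. finite F \<longrightarrow> (\<Sum>i\<in>F. (cmod (coord (X m) i - f i))\<^sup>2) \<le> 1\<^sup>2"
      using bound[of 1] by auto
    have "(\<lambda>i. (cmod (coord (X m) i + - 1 * (coord (X m) i - f i)))\<^sup>2) summable_on UNIV"
      by (intro square_summable_add square_summable_scale coord_summable diff[OF m])
    then show ?thesis by simp
  qed
  then have cf: "coord (Abs_ell2 f) = f"
    by (simp add: Abs_ell2_inverse)
  have "X \<longlonglongrightarrow> Abs_ell2 f"
  proof (rule metric_LIMSEQ_I)
    fix e :: real assume "0 < e"
    then obtain N where
      N: "\<And>m. m \<ge> N \<Longrightarrow> \<forall>F. finite F \<longrightarrow> (\<Sum>i\<in>F. (cmod (coord (X m) i - f i))\<^sup>2) \<le> (e / 2)\<^sup>2"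
      using bound[of "e / 2"] by auto
    have "dist (X m) (Abs_ell2 f) < e" if "m \<ge> N" for m
    proof -
      have "(norm (X m - Abs_ell2 f))\<^sup>2 = (\<Sum>\<^sub>\<infinity>i. (cmod (coord (X m) i - f i))\<^sup>2)"
        by (simp add: norm_ell2_square minus_ell2.rep_eq cf)
      also have "\<dots> \<le> (e / 2)\<^sup>2"
        using N[OF that] diff[OF N[OF that]] by (intro infsum_le_finite_sums) auto
      finally have "norm (X m - Abs_ell2 f) \<le> e / 2"
        using \<open>0 < e\<close> by (simp add: power2_le_iff_abs_le)
      then show ?thesis using \<open>0 < e\<close> by (simp add: dist_norm)
    qed
    then show "\<exists>N. \<forall>m\<ge>N. dist (X m) (Abs_ell2 f) < e" by blast
  qed
  then show "convergent X" by (rule convergentI)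
qed

lift_definition ket :: "'i \<Rightarrow> 'i ell2" is "\<lambda>i j. if j = i then 1 else 0"
  subgoal for i
  proof -
    have "(\<lambda>j. (cmod (if j = i then 1 else 0))\<^sup>2) summable_on {i}"
      by (rule summable_on_finite) simp
    then show ?thesis
      by (rule summable_on_cong_neutral[THEN iffD1, rotated -1]) auto
  qed
  done


section \<open>The full Fock space and the noncommutative analytic Toeplitz algebra\<close>

text \<open>
  The elements of the finite type \<open>'n\<close> are the generators of the free semigroup, so that
  \<open>n = CARD('n)\<close> and words are lists. The Fock space is realised through the coordinates with
  respect to its orthonormal basis \<open>e\<^sub>\<alpha> = ket \<alpha>\<close>: the tensor power of order \<open>k\<close> consists of the
  families supported on words of length \<open>k\<close>, and \<open>1 = ket []\<close>.
\<close>

type_synonym 'n fock = "'n list ell2"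

text \<open>\<open>creation i \<phi> = e\<^sub>i \<otimes> \<phi>\<close>, hence \<open>creation i\<close> maps \<open>e\<^sub>\<alpha>\<close> to \<open>e\<^sub>i \<otimes> e\<^sub>\<alpha>\<close>.\<close>

lift_definition creation :: "'n \<Rightarrow> 'n fock \<Rightarrow> 'n fock" is
  "\<lambda>i f \<alpha>. case \<alpha> of [] \<Rightarrow> 0 | j # \<beta> \<Rightarrow> if j = i then f \<beta> else 0"
  subgoal premises prems for i f
  proof -
    let ?g = "\<lambda>\<alpha>. (cmod (case \<alpha> of [] \<Rightarrow> 0 | j # \<beta> \<Rightarrow> if j = i then f \<beta> else 0))\<^sup>2"
    have "?g summable_on range ((#) i)"
      by (subst summable_on_reindex) (use prems in \<open>auto simp: comp_def\<close>)
    then show ?thesis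
      by (rule summable_on_cong_neutral[THEN iffD1, rotated -1]) (auto split: list.splits)
  qed
  done

lemma creation_ket: "creation i (ket \<alpha>) = ket (i # \<alpha>)"
  by transfer (auto simp: fun_eq_iff split: list.splits)

definition F_infty :: "('n::finite fock \<Rightarrow> 'n fock) set" where
  "F_infty = wot_closed_algebra_generated (insert id (range creation))"

text \<open>\<open>\<N>\<^sub>J\<close>, the orthogonal complement of the closure of \<open>J F\<^sup>2(H\<^sub>n)\<close>\<close>

definition N_space :: "('n::finite fock \<Rightarrow> 'n fock) set \<Rightarrow> 'n fock set" where
  "N_space J = orth_compl (closed_cspan (\<Union>\<phi>\<in>J. range \<phi>))"


section \<open>Row contractions, functional calculus and constrained pieces\<close>

definition word_op :: "('n \<Rightarrow> 'a \<Rightarrow> 'a) \<Rightarrow> 'n list \<Rightarrow> 'a \<Rightarrow> 'a" where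
  "word_op T \<alpha> = foldr (\<lambda>i X. T i \<circ> X) \<alpha> id"

definition row_contraction :: "('n::finite \<Rightarrow> 'a::chilbert_space \<Rightarrow> 'a) \<Rightarrow> bool" where
  "row_contraction T \<longleftrightarrow>
     (\<forall>i. bounded_clinear (T i)) \<and>
     (\<forall>h. Re (cinner (\<Sum>i\<in>UNIV. T i (cadjoint (T i) h)) h) \<le> Re (cinner h h))"

definition completely_non_coisometric :: "('n::finite \<Rightarrow> 'a::chilbert_space \<Rightarrow> 'a) \<Rightarrow> bool" where
  "completely_non_coisometric T \<longleftrightarrow>
     \<not> (\<exists>h. h \<noteq> 0 \<and>
         (\<forall>k\<ge>1. (\<Sum>\<alpha> | length \<alpha> = k. (norm (cadjoint (word_op T \<alpha>) h))\<^sup>2) = (norm h)\<^sup>2))"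

definition compression :: "'a::chilbert_space set \<Rightarrow> ('a \<Rightarrow> 'a) \<Rightarrow> 'a \<Rightarrow> 'a" where
  "compression M T = restrict (orth_proj M \<circ> T) M"

text \<open>
  \<open>has_fcalculus \<phi> M T X\<close> states that \<open>\<phi>(T\<^sub>1, \<dots>, T\<^sub>n) = X\<close>, where \<open>T\<^sub>1, \<dots>, T\<^sub>n\<close> and \<open>X\<close> are
  operators on the Hilbert space \<open>M\<close>, a closed subspace of the ambient type: the strong operator
  limit exists and equals \<open>X\<close>. Here \<open>coord (\<phi> (ket [])) \<alpha>\<close> is the Fourier coefficient
  \<open>a\<^sub>\<alpha>\<close> of \<open>\<phi>(1)\<close>.
\<close>

definition has_fcalculus ::
  "('n::finite fock \<Rightarrow> 'n fock) \<Rightarrow> 'a::chilbert_space set \<Rightarrow> ('n \<Rightarrow> 'a \<Rightarrow> 'a) \<Rightarrow> ('a \<Rightarrow> 'a) \<Rightarrow> bool" where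
  "has_fcalculus \<phi> M T X \<longleftrightarrow>
     (\<forall>h\<in>M. ((\<lambda>r::real. \<Sum>k. \<Sum>\<alpha> | length \<alpha> = k.
         (complex_of_real (r ^ length \<alpha>) * coord (\<phi> (ket [])) \<alpha>) *\<^sub>C word_op T \<alpha> h) \<longlongrightarrow> X h) (at_left 1))"

definition constrained_subspaces ::
  "('n::finite fock \<Rightarrow> 'n fock) set \<Rightarrow> ('n \<Rightarrow> 'a::chilbert_space \<Rightarrow> 'a) \<Rightarrow> 'a set set" where
  "constrained_subspaces C T =
     {M. closed_csubspace M \<and> (\<forall>i. cadjoint (T i) ` M \<subseteq> M) \<and>
         (\<forall>\<phi>\<in>C. has_fcalculus \<phi> M (\<lambda>i. compression M (T i)) (\<lambda>h. 0))}"

definition max_constrained_space ::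
  "('n::finite fock \<Rightarrow> 'n fock) set \<Rightarrow> ('n \<Rightarrow> 'a::chilbert_space \<Rightarrow> 'a) \<Rightarrow> 'a set" where
  "max_constrained_space C T = closed_cspan (\<Union> (constrained_subspaces C T))"

text \<open>
  The tuple \<open>B\<close> of operators on the space \<open>M\<close> is the maximal \<open>C\<close>-constrained piece of \<open>T\<close>; the
  first three conjuncts are the standing assumptions under which this notion is defined.
\<close>

definition is_max_constrained_piece ::
  "('n::finite fock \<Rightarrow> 'n fock) set \<Rightarrow> ('n \<Rightarrow> 'a::chilbert_space \<Rightarrow> 'a) \<Rightarrow> 'a set \<Rightarrow> ('n \<Rightarrow> 'a \<Rightarrow> 'a) \<Rightarrow> bool" where
  "is_max_constrained_piece C T M B \<longleftrightarrow>
     row_contraction T \<and> completely_non_coisometric T \<and> C \<subseteq> F_infty \<and>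
     M = max_constrained_space C T \<and> B = (\<lambda>i. compression M (T i))"

end

theory Submission
  imports Defs
begin

text \<open>
  An operator \<open>\<phi> \<in> F\<^sub>n\<^sup>\<infinity>\<close> commutes with the right creation operators, hence is left multiplication by
  \<open>\<phi>(1)\<close>. Its dilations \<open>\<phi>\<^sub>r\<close> arise from \<open>\<phi>\<close> by the Schur multiplier \<open>r ^ (|\<gamma>| - |\<beta>|)\<close>, which is
  contractive, so \<open>\<phi>\<^sub>r\<close> tends strongly to \<open>\<phi>\<close>. For a co-invariant subspace \<open>M\<close> this gives
  \<open>\<phi>(P\<^sub>M S\<^sub>1|M, \<dots>, P\<^sub>M S\<^sub>n|M) = P\<^sub>M \<phi>|M\<close>, and since \<open>\<phi>\<close> leaves the orthogonal complement of \<open>M\<close> invariant, this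
  compression vanishes iff the range of \<open>\<phi>\<close> is orthogonal to \<open>M\<close>. So the constrained subspaces are
  contained in \<open>\<N>\<^sub>J\<close>, which is itself constrained because \<open>J\<close> is a left ideal.
\<close>

section \<open>Complex Hilbert spaces and orthogonal projections\<close>

instance chilbert_space \<subseteq> banach ..

lemma cinner_add_right: "cinner x (y + z) = cinner x y + cinner x (z::'a::complex_inner)"
  by (metis cinner_add_left cinner_commute complex_cnj_add)

lemma cinner_scaleC_right: "cinner x (a *\<^sub>C y) = cnj a * cinner x (y::'a::complex_inner)"
  by (metis cinner_scaleC_left cinner_commute complex_cnj_mult)

text \<open>Since \<open>cinner\<close> is conjugate-linear in its second argument, pairing with
  \<open>\<i> *\<^sub>C y\<close> exposes the imaginary part. Continuity and orthogonality questions
  thus reduce to the real \<open>inner\<close>.\<close>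

lemma cinner_eq_inner: "cinner x y = complex_of_real (inner x y) + \<i> * complex_of_real (inner x (\<i> *\<^sub>C y))"
  for x y :: "'a::complex_inner"
  by (simp add: complex_eq_iff flip: Re_cinner) (simp add: cinner_scaleC_right)

lemma bounded_linear_cinner_left: "bounded_linear (\<lambda>x. cinner x (y::'a::complex_inner))"
  unfolding cinner_eq_inner
  by (intro bounded_linear_add bounded_linear_compose[OF bounded_linear_of_real] bounded_linear_inner_left
      bounded_linear_const_mult)

lemma bounded_linear_cinner_right: "bounded_linear (\<lambda>x. cinner (y::'a::complex_inner) x)"
  unfolding cinner_commute[of y]
  by (intro bounded_linear_compose[OF bounded_linear_cnj] bounded_linear_cinner_left)

lemmas cinner_linear_simps =
  linear_0[OF bounded_linear.linear[OF bounded_linear_cinner_left]] linear_0[OF bounded_linear.linear[OF bounded_linear_cinner_right]]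
  linear_diff[OF bounded_linear.linear[OF bounded_linear_cinner_left]] linear_diff[OF bounded_linear.linear[OF bounded_linear_cinner_right]]
  cinner_add_left cinner_add_right cinner_scaleC_left cinner_scaleC_right

lemma cinner_self: "cinner x x = complex_of_real ((norm x)\<^sup>2)" for x :: "'a::complex_inner"
proof -
  have "Im (cinner x x) = 0"
    using arg_cong[OF cinner_commute[of x x], of Im] by simp
  then show ?thesis
    by (simp add: complex_eq_iff Re_cinner power2_norm_eq_inner)
qed

lemma cinner_eqI: "(\<And>y. cinner x y = cinner z y) \<Longrightarrow> x = z" for x z :: "'a::complex_inner"
proof -
  assume "\<And>y. cinner x y = cinner z y"
  then have "cinner (x - z) (x - z) = 0" by (simp add: cinner_linear_simps)
  then show ?thesis by (simp add: cinner_self)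
qed

lemma norm_scaleC: "norm (c *\<^sub>C x) = cmod c * norm x" for x :: "'a::complex_inner"
proof -
  have "cinner (c *\<^sub>C x) (c *\<^sub>C x) = (c * cnj c) * cinner x x"
    by (simp add: cinner_linear_simps)
  then have "complex_of_real ((norm (c *\<^sub>C x))\<^sup>2) = complex_of_real ((cmod c * norm x)\<^sup>2)"
    unfolding cinner_self complex_norm_square[symmetric] power_mult_distrib of_real_mult .
  then have "(norm (c *\<^sub>C x))\<^sup>2 = (cmod c * norm x)\<^sup>2"
    by (simp only: of_real_eq_iff)
  then show ?thesis
    by (simp add: power2_eq_iff_nonneg)
qed

lemma bounded_linear_scaleC: "bounded_linear (\<lambda>x::'a::complex_inner. c *\<^sub>C x)"
proof (rule bounded_linear_intro)
  show "c *\<^sub>C r *\<^sub>R x = r *\<^sub>R c *\<^sub>C x" for r and x :: 'a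
    by (simp add: scaleR_scaleC scaleC_scaleC mult.commute)
  show "norm (c *\<^sub>C x) \<le> norm x * cmod c" for x :: 'a
    by (simp add: norm_scaleC)
qed (rule scaleC_add_right)

lemma bounded_clinearD:
  assumes "bounded_clinear T"
  shows "bounded_linear T" "T (c *\<^sub>C x) = c *\<^sub>C T x" "T (x + y) = T x + T y" "T (x - y) = T x - T y" "T 0 = 0"
  using assms unfolding bounded_clinear_def
  by (auto simp: bounded_linear.linear linear_add linear_diff linear_0)

lemma bounded_clinear_zero: "bounded_clinear (\<lambda>x. 0)"
  by (simp add: bounded_clinear_def linear_0[OF bounded_linear.linear[OF bounded_linear_scaleC]])

lemma bounded_clinear_id: "bounded_clinear id"
  by (simp add: bounded_clinear_def id_def)

lemma bounded_clinear_add: "bounded_clinear S \<Longrightarrow> bounded_clinear T \<Longrightarrow> bounded_clinear (\<lambda>x. S x + T x)"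
  by (auto simp: bounded_clinear_def scaleC_add_right intro: bounded_linear_add)

lemma bounded_clinear_scaleC: "bounded_clinear T \<Longrightarrow> bounded_clinear (\<lambda>x. c *\<^sub>C T x)"
  unfolding bounded_clinear_def
  using bounded_linear_compose[OF bounded_linear_scaleC, of T c] by (simp add: scaleC_scaleC mult.commute)

lemma bounded_clinear_comp: "bounded_clinear S \<Longrightarrow> bounded_clinear T \<Longrightarrow> bounded_clinear (S \<circ> T)"
  unfolding bounded_clinear_def o_def using bounded_linear_compose[of S T] by simp

lemma cadjoint_eqI:
  assumes "\<And>x y. cinner (T x) y = cinner x (G y)"
  shows "cadjoint T = G"
  unfolding cadjoint_def
proof (rule the_equality)
  fix G' assume G': "\<forall>x y. cinner (T x) y = cinner x (G' y)"
  have "cinner (G' y - G y) (G' y - G y) = 0" for y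
    using G' assms by (simp add: cinner_linear_simps)
  then show "G' = G"
    by (auto simp: cinner_self)
qed (use assms in simp)

section \<open>Orthogonal projections onto closed complex subspaces\<close>

lemma orthogonal_of_minimal:
  fixes w z :: "'a::real_inner"
  assumes "\<And>t. norm w \<le> norm (w - t *\<^sub>R z)"
  shows "inner w z = 0"
proof (cases "z = 0")
  case False
  \<comment> \<open>This is the minimiser of the quadratic \<open>norm (w - t *\<^sub>R z)\<close>
    squared; at it the value drops by exactly the squared component of \<open>w\<close> along
    \<open>z\<close>.\<close>
  define t where "t = inner w z / (norm z)\<^sup>2"
  have "(norm w)\<^sup>2 \<le> (norm (w - t *\<^sub>R z))\<^sup>2"
    using assms by (simp add: power_mono)
  also have "\<dots> = (norm w)\<^sup>2 - 2 * t * inner w z + t\<^sup>2 * (norm z)\<^sup>2"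
    unfolding power2_norm_eq_inner
    by (simp add: inner_diff inner_commute[of z w] power2_eq_square algebra_simps)
  also have "\<dots> = (norm w)\<^sup>2 - (inner w z)\<^sup>2 / (norm z)\<^sup>2"
    using False by (simp add: t_def power2_eq_square field_simps)
  finally have "(inner w z)\<^sup>2 / (norm z)\<^sup>2 \<le> 0" by simp
  then show ?thesis using False by (simp add: divide_le_0_iff)
qed simp

lemma closed_csubspaceD:
  assumes "closed_csubspace M"
  shows "closed M" "0 \<in> M" "x \<in> M \<Longrightarrow> y \<in> M \<Longrightarrow> x + y \<in> M" "x \<in> M \<Longrightarrow> c *\<^sub>C x \<in> M"
    "x \<in> M \<Longrightarrow> r *\<^sub>R x \<in> M" "x \<in> M \<Longrightarrow> y \<in> M \<Longrightarrow> x - y \<in> M"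
proof -
  show *: "closed M" "0 \<in> M" "x \<in> M \<Longrightarrow> y \<in> M \<Longrightarrow> x + y \<in> M" "x \<in> M \<Longrightarrow> c *\<^sub>C x \<in> M" for x y c
    using assms by (auto simp: closed_csubspace_def)
  show r: "x \<in> M \<Longrightarrow> r *\<^sub>R x \<in> M" for x r
    using *(4) by (simp add: scaleR_scaleC)
  show "x \<in> M \<Longrightarrow> y \<in> M \<Longrightarrow> x - y \<in> M"
    using *(3)[of x "- y"] r[of y "-1"] by simp
qed

text \<open>A sequence in \<open>M\<close> whose distances to \<open>x\<close> approach the infimum
  is Cauchy: midpoints stay in \<open>M\<close>, so the parallelogram law bounds the mutual
  distances by the excess over \<open>d\<close>. Completeness and closedness supply the
  limit.\<close>

lemma closest_point_in_closed_csubspace: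
  assumes M: "closed_csubspace M"
  shows "\<exists>y\<in>M. \<forall>z\<in>M. norm (x - y) \<le> norm (x - z)"
proof -
  note M = closed_csubspaceD[OF M]
  define d where "d = infdist x M"
  have d: "d \<le> norm (x - z)" if "z \<in> M" for z
    using infdist_le[OF that, of x] by (simp add: d_def dist_norm)
  have "d \<ge> 0" by (simp add: d_def infdist_nonneg)
  have "\<exists>y\<in>M. norm (x - y) < d + e" if "e > 0" for e
  proof -
    have "bdd_below (dist x ` M)" "M \<noteq> {}"
      using M(2) by (auto intro: bdd_belowI2[where m = 0])
    then show ?thesis
      using that cINF_less_iff[of M "dist x" "d + e"] by (simp add: d_def infdist_notempty dist_norm)
  qed
  then have "\<forall>n. \<exists>y\<in>M. norm (x - y) < d + 1 / Suc n" by simp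
  then obtain y where y: "\<And>n. y n \<in> M" "\<And>n. norm (x - y n) < d + 1 / Suc n" by metis
  have lim: "(\<lambda>n. d + 1 / Suc n) \<longlonglongrightarrow> d"
    using tendsto_add[OF tendsto_const[of d] LIMSEQ_inverse_real_of_nat] by (simp add: inverse_eq_divide)
  have par: "(norm (y m - y n))\<^sup>2 \<le> 4 * ((d + 1 / Suc N)\<^sup>2 - d\<^sup>2)" if "m \<ge> N" "n \<ge> N" for m n N
  proof -
    have b: "(norm (x - y k))\<^sup>2 \<le> (d + 1 / Suc N)\<^sup>2" if "k \<ge> N" for k
    proof -
      have "1 / real (Suc k) \<le> 1 / Suc N"
        using that by (intro divide_left_mono) auto
      then show ?thesis using y(2)[of k] by (intro power_mono) auto
    qed
    have "d\<^sup>2 \<le> (norm (x - (1/2) *\<^sub>R (y m + y n)))\<^sup>2"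
      using \<open>d \<ge> 0\<close> by (intro power_mono d M y)
    moreover have "(norm (y m - y n))\<^sup>2 + 4 * (norm (x - (1/2) *\<^sub>R (y m + y n)))\<^sup>2
        = 2 * (norm (x - y m))\<^sup>2 + 2 * (norm (x - y n))\<^sup>2"
      by (simp add: power2_norm_eq_inner inner_diff inner_add inner_commute algebra_simps)
    ultimately show ?thesis using b[OF that(1)] b[OF that(2)] by simp
  qed
  have "Cauchy y"
  proof (rule metric_CauchyI)
    fix e :: real assume "e > 0"
    have "(\<lambda>N. 4 * ((d + 1 / Suc N)\<^sup>2 - d\<^sup>2)) \<longlonglongrightarrow> 4 * (d\<^sup>2 - d\<^sup>2)"
      by (intro tendsto_intros lim)
    then have "\<forall>\<^sub>F N in sequentially. 4 * ((d + 1 / Suc N)\<^sup>2 - d\<^sup>2) < e\<^sup>2"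
      using \<open>e > 0\<close> by (intro order_tendstoD(2)) auto
    then obtain N where "4 * ((d + 1 / Suc N)\<^sup>2 - d\<^sup>2) < e\<^sup>2"
      by (auto simp: eventually_sequentially)
    then have "(norm (y m - y n))\<^sup>2 < e\<^sup>2" if "m \<ge> N" "n \<ge> N" for m n
      using par[OF that] by (rule le_less_trans[rotated])
    then have "dist (y m) (y n) < e" if "m \<ge> N" "n \<ge> N" for m n
      using that \<open>e > 0\<close> unfolding dist_norm by (meson less_imp_le power_less_imp_less_base)
    then show "\<exists>N. \<forall>m\<ge>N. \<forall>n\<ge>N. dist (y m) (y n) < e" by blast
  qed
  then obtain l where l: "y \<longlonglongrightarrow> l"
    using Cauchy_convergent convergentD by blast
  have "l \<in> M"
    using closed_sequentially[OF M(1)] y(1) l by blast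
  moreover have "norm (x - l) \<le> d"
    by (rule LIMSEQ_le[OF _ lim, where X = "\<lambda>n. norm (x - y n)"])
      (use y(2) in \<open>auto intro!: tendsto_intros l less_imp_le\<close>)
  ultimately show ?thesis
    using d by (meson order_trans)
qed

lemma closed_csubspace_orth_compl: "closed_csubspace (orth_compl M)"
proof -
  have "orth_compl M = (\<Inter>y\<in>M. (\<lambda>x. cinner x y) -` {0})"
    by (auto simp: orth_compl_def)
  then have "closed (orth_compl M)"
    by (auto intro!: closed_INT continuous_closed_vimage linear_continuous_at bounded_linear_cinner_left)
  then show ?thesis
    by (auto simp: closed_csubspace_def orth_compl_def cinner_linear_simps)
qed

lemma ex_orth_proj:
  assumes M: "closed_csubspace M"
  shows "\<exists>y\<in>M. x - y \<in> orth_compl M"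
proof -
  note MD = closed_csubspaceD[OF M]
  obtain y where y: "y \<in> M" "\<And>z. z \<in> M \<Longrightarrow> norm (x - y) \<le> norm (x - z)"
    using closest_point_in_closed_csubspace[OF M] by blast
  have "inner (x - y) z = 0" if "z \<in> M" for z
  proof (rule orthogonal_of_minimal)
    show "norm (x - y) \<le> norm (x - y - t *\<^sub>R z)" for t
      using y(2)[of "y + t *\<^sub>R z"] y(1) that by (simp add: MD diff_diff_eq)
  qed
  \<comment> \<open>Real orthogonality is applied to both \<open>z\<close> and
    \<open>\<i> *\<^sub>C z\<close>, which lies in the complex subspace \<open>M\<close> as
    well.\<close>
  then have "cinner (x - y) z = 0" if "z \<in> M" for z
    using that by (simp add: cinner_eq_inner MD)
  then show ?thesis using y(1) by (auto simp: orth_compl_def)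
qed

lemma orth_proj_eqI:
  assumes M: "closed_csubspace M" and y: "y \<in> M" "x - y \<in> orth_compl M"
  shows "orth_proj M x = y"
  unfolding orth_proj_def
proof (rule the_equality)
  fix z assume z: "z \<in> M \<and> x - z \<in> orth_compl M"
  then have "(x - y) - (x - z) \<in> orth_compl M" "z - y \<in> M"
    using closed_csubspaceD(6) closed_csubspace_orth_compl M y by blast+
  then have "cinner (z - y) (z - y) = 0" by (auto simp: orth_compl_def)
  then show "z = y" by (simp add: cinner_self)
qed (use y in simp)

lemma
  assumes "closed_csubspace M"
  shows orth_proj_in: "orth_proj M x \<in> M"
    and diff_orth_proj: "x - orth_proj M x \<in> orth_compl M"
  using ex_orth_proj[OF assms, of x] orth_proj_eqI[OF assms, of _ x] by metis+

lemma bounded_clinear_orth_proj: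
  assumes M: "closed_csubspace M"
  shows "bounded_clinear (orth_proj M)"
proof -
  note P = orth_proj_in[OF M] diff_orth_proj[OF M]
  note D = closed_csubspaceD[OF M] closed_csubspaceD[OF closed_csubspace_orth_compl[of M]]
  have add: "orth_proj M (x + y) = orth_proj M x + orth_proj M y" for x y
    using D(9)[OF P(2)[of x] P(2)[of y]] by (intro orth_proj_eqI M D(3) P) (simp add: algebra_simps)
  have sc: "orth_proj M (c *\<^sub>C x) = c *\<^sub>C orth_proj M x" for c x
    using D(10)[OF P(2)[of x], of c]
    by (intro orth_proj_eqI M D(4) P) (simp add: linear_diff bounded_linear.linear[OF bounded_linear_scaleC])
  have "norm (orth_proj M x) \<le> norm x" for x
  proof -
    have "inner (x - orth_proj M x) (orth_proj M x) = 0"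
      using P(1)[of x] P(2)[of x] by (simp add: orth_compl_def flip: Re_cinner)
    then have "(norm x)\<^sup>2 = (norm (orth_proj M x))\<^sup>2 + (norm (x - orth_proj M x))\<^sup>2"
      by (simp add: power2_norm_eq_inner inner_diff inner_commute)
    then show ?thesis by (simp add: power2_le_imp_le)
  qed
  then have "bounded_linear (orth_proj M)"
    by (intro bounded_linear_intro[where K = 1]) (auto simp: add sc scaleR_scaleC)
  then show ?thesis by (simp add: bounded_clinear_def sc)
qed

lemma orth_proj_eq_0_iff:
  assumes "closed_csubspace M"
  shows "orth_proj M x = 0 \<longleftrightarrow> x \<in> orth_compl M"
  using orth_proj_eqI[OF assms, of 0 x] diff_orth_proj[OF assms, of x] closed_csubspaceD(2)[OF assms] by auto

lemma orth_proj_of_mem: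
  assumes "closed_csubspace M" "x \<in> M"
  shows "orth_proj M x = x"
  using assms by (intro orth_proj_eqI) (auto simp: orth_compl_def cinner_linear_simps)

text \<open>The double complement of \<open>A\<close> is a closed subspace containing
  \<open>A\<close>, so it contains the hull.\<close>

lemma orth_compl_closed_cspan: "orth_compl (closed_cspan A) = orth_compl A"
proof
  show "orth_compl (closed_cspan A) \<subseteq> orth_compl A"
    using hull_subset[of A closed_csubspace] by (auto simp: orth_compl_def closed_cspan_def)
  have sym: "cinner x y = 0 \<longleftrightarrow> cinner y x = 0" for x y :: 'a
    by (metis cinner_commute complex_cnj_zero)
  have "closed_cspan A \<subseteq> orth_compl (orth_compl A)"
    unfolding closed_cspan_def
    by (intro hull_minimal closed_csubspace_orth_compl) (auto simp: orth_compl_def sym)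
  then show "orth_compl A \<subseteq> orth_compl (closed_cspan A)"
    unfolding orth_compl_def using sym by blast
qed

section \<open>The weak operator topology\<close>

lemma topspace_wot: "topspace wot = {T. bounded_clinear T}"
proof -
  \<comment> \<open>A subbasic set with \<open>U = UNIV\<close> imposes nothing beyond boundedness
    and linearity.\<close>
  have "{T. bounded_clinear T \<and> cinner (T 0) 0 \<in> (UNIV :: complex set)} \<subseteq> topspace wot"
    unfolding wot_def topology_generated_by_topspace using open_UNIV by blast
  then show ?thesis
    unfolding wot_def topology_generated_by_topspace by auto
qed

lemma continuous_map_wot: "continuous_map wot euclidean (\<lambda>T. cinner (T x) y)"
proof -
  have "openin wot {T. bounded_clinear T \<and> cinner (T x) y \<in> U}" if "open U" for U
    unfolding wot_def using that by (intro topology_generated_by_Basis) blast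
  then show ?thesis
    by (auto simp: continuous_map_def topspace_wot)
qed

text \<open>Commutation relations and invariance of orthogonal complements are both families of
  equations between matrix coefficients, so this one shape serves every WOT-closedness argument
  below.\<close>

lemma closedin_wot_cinner_eq:
  "closedin wot {T. bounded_clinear T \<and> (\<forall>(x, y, u, v)\<in>Q. cinner (T x) y = cinner (T u) v)}"
proof -
  have "closedin wot {T \<in> topspace wot. cinner (T x) y = cinner (T u) v}" for x y u v :: 'a
    by (intro closedin_continuous_maps_eq[where Y = euclidean] continuous_map_wot Hausdorff_space_euclidean)
  \<comment> \<open>Inserting \<open>topspace wot\<close> keeps the intersection correct when
    \<open>Q\<close> is empty.\<close>
  then have "closedin wot (\<Inter>(insert (topspace wot)
      ((\<lambda>(x, y, u, v). {T \<in> topspace wot. cinner (T x) y = cinner (T u) v}) ` Q)))"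
    by (intro closedin_Inter) auto
  moreover have "{T. bounded_clinear T \<and> (\<forall>(x, y, u, v)\<in>Q. cinner (T x) y = cinner (T u) v)} =
     \<Inter>(insert (topspace wot) ((\<lambda>(x, y, u, v). {T \<in> topspace wot. cinner (T x) y = cinner (T u) v}) ` Q))"
    by (auto simp: topspace_wot)
  ultimately show ?thesis by simp
qed

section \<open>Operators on square-summable families\<close>

lemma ell2_eqI: "(\<And>i. coord x i = coord y i) \<Longrightarrow> x = y"
  by (simp add: coord_inject[symmetric] fun_eq_iff)

lemmas coord_simps = zero_ell2.rep_eq plus_ell2.rep_eq minus_ell2.rep_eq uminus_ell2.rep_eq
  scaleR_ell2.rep_eq scaleC_ell2.rep_eq ket.rep_eq

lemma cinner_ket: "cinner x (ket i) = coord x i"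
proof -
  have "(\<Sum>\<^sub>\<infinity>j. coord x j * cnj (coord (ket i) j)) = (\<Sum>\<^sub>\<infinity>j\<in>{i}. coord x j * cnj (coord (ket i) j))"
    by (intro infsum_cong_neutral) (auto simp: coord_simps)
  then show ?thesis
    by (simp add: cinner_ell2_def coord_simps)
qed

lemma bounded_linear_coord: "bounded_linear (\<lambda>x. coord x i)"
  using bounded_linear_cinner_left[of "ket i"] by (simp add: cinner_ket)

lemma coord_sum: "coord (\<Sum>i\<in>I. f i) j = (\<Sum>i\<in>I. coord (f i) j)"
  by (rule linear_sum[OF bounded_linear.linear[OF bounded_linear_coord]])

text \<open>The component of a vector orthogonal to \<open>M\<close> has all coordinates zero. This
  is the density principle used later: identities between bounded operators are checked on basis
  vectors only.\<close>

lemma closed_csubspace_UNIV_if_ket: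
  assumes M: "closed_csubspace M" and ket: "\<And>i. ket i \<in> M"
  shows "M = UNIV"
proof -
  have "x \<in> M" for x
  proof -
    have "coord (x - orth_proj M x) i = 0" for i
      using diff_orth_proj[OF M, of x] ket unfolding orth_compl_def cinner_ket[symmetric] by blast
    then have "x - orth_proj M x = 0"
      by (intro ell2_eqI) (simp add: coord_simps)
    then show ?thesis
      using orth_proj_in[OF M, of x] by simp
  qed
  then show ?thesis by blast
qed

text \<open>The vectors at which convergence holds form a subspace, closed because of the bound
  \<open>K\<close> uniform in \<open>r\<close>. The hypotheses are only eventual because the
  dilations below are controlled just for \<open>0 \<le> r < 1\<close>.\<close>

lemma tendsto_of_tendsto_ket:
  fixes L :: "'b \<Rightarrow> 'i ell2 \<Rightarrow> 'a::chilbert_space"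
  assumes lin: "\<forall>\<^sub>F r in F. (\<forall>x y. L r (x + y) = L r x + L r y) \<and> (\<forall>c x. L r (c *\<^sub>C x) = c *\<^sub>C L r x)
      \<and> (\<forall>x. norm (L r x) \<le> K * norm x)"
    and G: "bounded_linear G" "\<And>c x. G (c *\<^sub>C x) = c *\<^sub>C G x"
    and ket: "\<And>i. ((\<lambda>r. L r (ket i)) \<longlongrightarrow> G (ket i)) F"
  shows "((\<lambda>r. L r x) \<longlongrightarrow> G x) F"
proof -
  define M where "M = {x. ((\<lambda>r. L r x) \<longlongrightarrow> G x) F}"
  obtain K0 where K0: "K0 > 0" "\<And>x. norm (G x) \<le> norm x * K0"
    using bounded_linear.pos_bounded[OF G(1)] by blast
  \<comment> \<open>\<open>B\<close> dominates \<open>L r\<close> and \<open>G\<close> jointly, so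
    replacing \<open>l\<close> by \<open>X n\<close> costs at most
    \<open>B * norm (X n - l)\<close>; the absolute value allows \<open>K\<close> of either
    sign.\<close>
  define B where "B = \<bar>K\<bar> + K0"
  have "B > 0" using K0 by (simp add: B_def)
  have "closed_csubspace M"
    unfolding closed_csubspace_def
  proof (intro conjI ballI allI)
    show "0 \<in> M"
    proof -
      have "\<forall>\<^sub>F r in F. L r 0 = 0"
        using lin by eventually_elim (metis add_cancel_right_right)
      then show ?thesis
        by (simp add: M_def linear_0[OF bounded_linear.linear[OF G(1)]] tendsto_eventually)
    qed
    show "x + y \<in> M" if "x \<in> M" "y \<in> M" for x y
    proof -
      have "((\<lambda>r. L r x + L r y) \<longlongrightarrow> G x + G y) F"
        using that by (auto simp: M_def intro: tendsto_add)
      moreover have "\<forall>\<^sub>F r in F. L r x + L r y = L r (x + y)"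
        using lin by eventually_elim simp
      ultimately show ?thesis
        by (simp add: M_def linear_add[OF bounded_linear.linear[OF G(1)]] tendsto_cong)
    qed
    show "c *\<^sub>C x \<in> M" if "x \<in> M" for x c
    proof -
      have "((\<lambda>r. c *\<^sub>C L r x) \<longlongrightarrow> c *\<^sub>C G x) F"
        using that by (auto simp: M_def intro: bounded_linear.tendsto[OF bounded_linear_scaleC])
      moreover have "\<forall>\<^sub>F r in F. c *\<^sub>C L r x = L r (c *\<^sub>C x)"
        using lin by eventually_elim simp
      ultimately show ?thesis
        by (simp add: M_def G(2) tendsto_cong)
    qed
    show "closed M"
    unfolding closed_sequential_limits
    proof (intro allI impI, elim conjE)
      fix X l
      assume X: "\<forall>n. X n \<in> M" "X \<longlonglongrightarrow> l"
      have "\<forall>\<^sub>F r in F. dist (L r l) (G l) < e" if "e > 0" for e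
      proof -
        have "e / (2 * B) > 0" using \<open>e > 0\<close> \<open>B > 0\<close> by simp
        then obtain n where n: "norm (X n - l) < e / (2 * B)"
          using LIMSEQ_D[OF X(2)] by blast
        have "\<forall>\<^sub>F r in F. dist (L r (X n)) (G (X n)) < e / 2"
          using X(1) \<open>e > 0\<close> by (intro tendstoD) (auto simp: M_def)
        with lin show ?thesis
        proof eventually_elim
          case (elim r)
          have "L r l = L r (X n) + L r (l - X n)"
            using elim(1) by (metis add.commute diff_add_cancel)
          then have "norm (L r l - G l) = norm ((L r (X n) - G (X n)) + L r (l - X n) - G (l - X n))"
            by (simp add: linear_diff[OF bounded_linear.linear[OF G(1)]])
          also have "\<dots> \<le> norm (L r (X n) - G (X n)) + norm (L r (l - X n)) + norm (G (l - X n))"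
            by (meson norm_triangle_ineq norm_triangle_ineq4 add_mono order_trans order_refl)
          also have "norm (L r (l - X n)) \<le> \<bar>K\<bar> * norm (l - X n)"
            using elim(1) by (meson abs_ge_self mult_right_mono norm_ge_zero order_trans)
          also have "norm (G (l - X n)) \<le> K0 * norm (l - X n)"
            using K0(2) by (simp add: mult.commute)
          finally have "norm (L r l - G l) \<le> dist (L r (X n)) (G (X n)) + B * norm (X n - l)"
            by (simp add: dist_norm B_def algebra_simps norm_minus_commute)
          also have "\<dots> < e / 2 + B * (e / (2 * B))"
            using elim(2) n \<open>B > 0\<close> by (intro add_strict_mono mult_strict_left_mono)
          also have "\<dots> = e" using \<open>B > 0\<close> by simp
          finally show ?case by (simp add: dist_norm)
        qed
      qed
      then show "l \<in> M" by (simp add: M_def tendstoI)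
    qed
  qed
  then have "M = UNIV"
    by (rule closed_csubspace_UNIV_if_ket) (simp add: M_def ket)
  then show ?thesis by (auto simp: M_def)
qed

text \<open>An isometry relabelling basis vectors along an injection, with adjoint
  \<open>pull p\<close>. Left creation operators are the case \<open>(#) i\<close>, right ones the
  case \<open>\<lambda>\<alpha>. \<alpha> @ \<beta>\<close>. The default 0 for non-injective
  \<open>p\<close> makes boundedness unconditional.\<close>

lift_definition push :: "('i \<Rightarrow> 'j) \<Rightarrow> 'i ell2 \<Rightarrow> 'j ell2" is
  "\<lambda>p f j. if inj p \<and> j \<in> range p then f (inv p j) else 0"
  subgoal premises prems for p f
  proof (cases "inj p")
    case True
    let ?g = "\<lambda>j. (cmod (if inj p \<and> j \<in> range p then f (inv p j) else 0))\<^sup>2"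
    have "?g summable_on range p"
      by (subst summable_on_reindex) (use prems True in \<open>auto simp: comp_def\<close>)
    then show ?thesis
      by (rule summable_on_cong_neutral[THEN iffD1, rotated -1]) auto
  qed simp
  done

lift_definition pull :: "('i \<Rightarrow> 'j) \<Rightarrow> 'j ell2 \<Rightarrow> 'i ell2" is
  "\<lambda>p f i. if inj p then f (p i) else 0"
  subgoal premises prems for p f
  proof (cases "inj p")
    case True
    have "(\<lambda>j. (cmod (f j))\<^sup>2) summable_on range p"
      using prems by (rule summable_on_subset_banach) simp
    then show ?thesis
      using True by (simp add: summable_on_reindex comp_def)
  qed simp
  done

lemma coord_push:
  assumes "inj p"
  shows "coord (push p x) (p i) = coord x i" "j \<notin> range p \<Longrightarrow> coord (push p x) j = 0"
  using assms by (simp_all add: push.rep_eq)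

lemma coord_pull: "inj p \<Longrightarrow> coord (pull p x) i = coord x (p i)"
  by (simp add: pull.rep_eq)

lemma cinner_push:
  assumes "inj p"
  shows "cinner (push p x) y = cinner x (pull p y)"
proof -
  have "cinner (push p x) y = (\<Sum>\<^sub>\<infinity>j\<in>range p. coord (push p x) j * cnj (coord y j))"
    unfolding cinner_ell2_def by (intro infsum_cong_neutral) (auto simp: coord_push assms)
  also have "\<dots> = cinner x (pull p y)"
    by (simp add: infsum_reindex assms cinner_ell2_def comp_def coord_push coord_pull)
  finally show ?thesis .
qed

lemma pull_push: "inj p \<Longrightarrow> pull p (push p x) = x"
  by (rule ell2_eqI) (simp add: coord_pull coord_push)

lemma norm_push:
  assumes "inj p"
  shows "norm (push p x) = norm x"
  using cinner_push[OF assms, of x "push p x"]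
  by (simp add: pull_push[OF assms] cinner_self del: of_real_power)

lemma push_ket: "inj p \<Longrightarrow> push p (ket i) = ket (p i)"
  by (rule ell2_eqI) (auto simp: push.rep_eq coord_simps)

lemma bounded_linear_push: "bounded_linear (push p)"
proof (cases "inj p")
  case True
  show ?thesis
    by (rule bounded_linear_intro[where K = 1])
      (auto simp: True norm_push intro!: ell2_eqI simp: push.rep_eq coord_simps)
next
  case False
  then have "push p = (\<lambda>x. 0)"
    by (auto intro!: ell2_eqI simp: push.rep_eq coord_simps)
  then show ?thesis by simp
qed

lemma push_scaleC: "push p (c *\<^sub>C x) = c *\<^sub>C push p x"
  by (rule ell2_eqI) (simp add: push.rep_eq coord_simps)

lemma bounded_clinear_push: "bounded_clinear (push p)"
  by (simp add: bounded_clinear_def bounded_linear_push push_scaleC)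

lemma cadjoint_push: "inj p \<Longrightarrow> cadjoint (push p) = pull p"
  by (intro cadjoint_eqI cinner_push)

lemma cinner_push_orthogonal:
  assumes "inj p" "inj q" "range p \<inter> range q = {}"
  shows "cinner (push p x) (push q y) = 0"
proof -
  have "pull p (push q y) = 0"
  proof (rule ell2_eqI)
    fix i
    have "p i \<notin> range q" using assms(3) by blast
    then show "coord (pull p (push q y)) i = coord 0 i"
      using assms by (simp add: coord_pull coord_push coord_simps)
  qed
  then show ?thesis
    by (simp add: cinner_push assms cinner_linear_simps)
qed

lemma norm_pull_square:
  assumes "inj p"
  shows "(norm (pull p x))\<^sup>2 = (\<Sum>\<^sub>\<infinity>j\<in>range p. (cmod (coord x j))\<^sup>2)"
  by (simp add: norm_ell2_square infsum_reindex assms comp_def coord_pull)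

text \<open>Each summand is the mass of \<open>x\<close> on one range, and disjoint ranges add up.
  For creation operators along the words of length \<open>k\<close> the result is the mass of
  \<open>x\<close> on words of length at least \<open>k\<close>.\<close>

lemma sum_norm_pull_square:
  assumes "finite I" and inj: "\<And>i. i \<in> I \<Longrightarrow> inj (p i)" and disj: "disjoint_family_on (\<lambda>i. range (p i)) I"
  shows "(\<Sum>i\<in>I. (norm (pull (p i) x))\<^sup>2) = (\<Sum>\<^sub>\<infinity>j\<in>(\<Union>i\<in>I. range (p i)). (cmod (coord x j))\<^sup>2)"
  using assms
proof (induction I)
  case (insert i I)
  have sm: "(\<lambda>j. (cmod (coord x j))\<^sup>2) summable_on A" for A
    by (rule summable_on_subset_banach[OF coord_summable]) simp
  have "range (p i) \<inter> (\<Union>i\<in>I. range (p i)) = {}"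
    using insert.prems(2) insert.hyps(2) by (auto 0 3 simp: disjoint_family_on_def)
  moreover have "disjoint_family_on (\<lambda>i. range (p i)) I"
    using insert.prems(2) by (rule disjoint_family_on_mono[rotated]) auto
  ultimately show ?case
    using insert by (simp add: infsum_Un_disjoint sm norm_pull_square)
qed simp

text \<open>A diagonal contraction with real entries, hence self-adjoint. It defaults to 0 when some
  entry exceeds 1 in modulus, so linearity and self-adjointness hold for every
  \<open>c\<close>.\<close>

lift_definition diag :: "('i \<Rightarrow> real) \<Rightarrow> 'i ell2 \<Rightarrow> 'i ell2" is
  "\<lambda>c f i. if (\<forall>i. \<bar>c i\<bar> \<le> 1) then complex_of_real (c i) * f i else 0"
  subgoal premises prems for c f
  proof (cases "\<forall>i. \<bar>c i\<bar> \<le> 1")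
    case True
    then have "(cmod (complex_of_real (c i) * f i))\<^sup>2 \<le> (cmod (f i))\<^sup>2" for i
      by (intro power_mono) (auto simp: norm_mult mult_left_le_one_le)
    then show ?thesis
      using summable_on_comparison_test[OF prems] by (simp add: True)
  next
    case False
    then show ?thesis by (simp only: if_False) simp
  qed
  done

lemma coord_diag: "(\<And>i. \<bar>c i\<bar> \<le> 1) \<Longrightarrow> coord (diag c x) i = complex_of_real (c i) * coord x i"
  by (simp add: diag.rep_eq)

lemma cinner_diag: "cinner (diag c x) y = cinner x (diag c y)"
  unfolding cinner_ell2_def by (intro infsum_cong) (simp add: diag.rep_eq mult_ac)

lemma diag_add: "diag c (x + y) = diag c x + diag c y"
  by (rule ell2_eqI) (simp add: diag.rep_eq coord_simps distrib_left)

lemma diag_scaleC: "diag c (a *\<^sub>C x) = a *\<^sub>C diag c x"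
  by (rule ell2_eqI) (simp add: diag.rep_eq coord_simps)

lemma diag_ket: "(\<And>i. \<bar>c i\<bar> \<le> 1) \<Longrightarrow> diag c (ket i) = complex_of_real (c i) *\<^sub>C ket i"
  by (rule ell2_eqI) (simp add: coord_diag coord_simps)

lemma has_sum_finite_sum:
  fixes f :: "'j \<Rightarrow> 'i \<Rightarrow> real"
  assumes "finite I" "\<And>j. (f j has_sum s j) A"
  shows "((\<lambda>i. \<Sum>j\<in>I. f j i) has_sum (\<Sum>j\<in>I. s j)) A"
  using assms(1) by (induction I) (auto intro!: has_sum_add assms(2))

text \<open>The column of the operators \<open>diag (c j)\<close> is a contraction: exchanging the
  two sums weights each coordinate by the sum of the \<open>(c j i)\<^sup>2\<close>.\<close>

lemma sum_norm_diag_square_le: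
  fixes x :: "'i ell2"
  assumes "finite I" and c: "\<And>j i. \<bar>c j i\<bar> \<le> 1" and le: "\<And>i. (\<Sum>j\<in>I. (c j i)\<^sup>2) \<le> 1"
  shows "(\<Sum>j\<in>I. (norm (diag (c j) x))\<^sup>2) \<le> (norm x)\<^sup>2"
proof -
  have hs: "((\<lambda>i. (cmod (coord y i))\<^sup>2) has_sum (norm y)\<^sup>2) UNIV" for y :: "'i ell2"
    unfolding norm_ell2_square by (intro has_sum_infsum coord_summable)
  show ?thesis
  proof (rule has_sum_mono[OF has_sum_finite_sum[OF \<open>finite I\<close>, of "\<lambda>j i. (cmod (coord (diag (c j) x) i))\<^sup>2", OF hs] hs])
    show "(\<Sum>j\<in>I. (cmod (coord (diag (c j) x) i))\<^sup>2) \<le> (cmod (coord x i))\<^sup>2" for i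
      using mult_right_mono[OF le[of i], of "(cmod (coord x i))\<^sup>2"]
      by (simp add: coord_diag c norm_mult power_mult_distrib sum_distrib_right)
  qed
qed

lemma norm_diag_le: "(\<And>i. \<bar>c i\<bar> \<le> 1) \<Longrightarrow> norm (diag c x) \<le> norm x"
  by (rule power2_le_imp_le) (use sum_norm_diag_square_le[of "{()}" "\<lambda>_. c" x] in \<open>simp_all add: abs_square_le_1\<close>)

section \<open>The noncommutative analytic Toeplitz algebra\<close>

lemma inj_append_left: "inj ((@) \<alpha>)" and inj_append_right: "inj (\<lambda>\<alpha>. \<alpha> @ \<beta>)"
  by (simp_all add: inj_def)

lemma creation_eq_push: "creation i = push ((#) i)"
proof (intro ext ell2_eqI)
  fix x :: "'a fock" and \<gamma> :: "'a list"
  show "coord (creation i x) \<gamma> = coord (push ((#) i) x) \<gamma>"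
    using coord_push[where p = "(#) i" and x = x] by (cases \<gamma>) (auto simp: creation.rep_eq inj_def)
qed

lemma bounded_clinear_creation: "bounded_clinear (creation i)"
  by (simp add: creation_eq_push bounded_clinear_push)

lemma cadjoint_creation: "cadjoint (creation i) = pull ((#) i)"
  by (simp add: creation_eq_push cadjoint_push inj_def)

lemma cinner_creation: "cinner (creation i x) y = cinner x (cadjoint (creation i) y)"
  by (simp add: creation_eq_push cadjoint_push cinner_push inj_def)

lemma word_op_simps: "word_op T [] = id" "word_op T (i # \<alpha>) = T i \<circ> word_op T \<alpha>"
  by (simp_all add: word_op_def)

lemma word_op_creation: "word_op creation \<alpha> = push ((@) \<alpha>)"
proof (induction \<alpha>)
  case Nil
  show ?case
  proof
    fix x :: "'a fock"
    have "coord (push ((@) []) x) i = coord x i" for i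
      using coord_push(1)[OF inj_append_left, of "[]" x i] by (simp only: append_Nil)
    then show "word_op creation [] x = push ((@) []) x"
      by (intro ell2_eqI) (simp only: word_op_simps id_apply)
  qed
next
  case (Cons i \<alpha>)
  show ?case
  proof (intro ext ell2_eqI)
    fix x \<gamma>
    show "coord (word_op creation (i # \<alpha>) x) \<gamma> = coord (push ((@) (i # \<alpha>)) x) \<gamma>"
    proof (cases "\<gamma> \<in> range ((@) (i # \<alpha>))")
      case True
      then obtain \<delta> where \<delta>: "\<gamma> = i # (\<alpha> @ \<delta>)" by auto
      have "coord (push ((@) (i # \<alpha>)) x) ((i # \<alpha>) @ \<delta>) = coord x \<delta>"
        by (rule coord_push(1)[OF inj_append_left])
      then show ?thesis
        by (simp add: word_op_simps Cons \<delta> creation.rep_eq coord_push(1)[OF inj_append_left])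
    next
      case False
      then have "\<gamma> = j # \<delta> \<Longrightarrow> j = i \<Longrightarrow> \<delta> \<notin> range ((@) \<alpha>)" for j \<delta> by auto
      then have "coord (word_op creation (i # \<alpha>) x) \<gamma> = 0"
        by (cases \<gamma>) (auto simp: word_op_simps Cons creation.rep_eq coord_push(2)[OF inj_append_left])
      then show ?thesis
        by (simp only: coord_push(2)[OF inj_append_left False])
    qed
  qed
qed

lemma coord_word_op_creation:
  "coord (word_op creation \<alpha> x) \<gamma> = (if take (length \<alpha>) \<gamma> = \<alpha> then coord x (drop (length \<alpha>) \<gamma>) else 0)"
proof (cases "take (length \<alpha>) \<gamma> = \<alpha>")
  case True
  then have "\<gamma> = \<alpha> @ drop (length \<alpha>) \<gamma>" by (metis append_take_drop_id)
  then show ?thesis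
    using True coord_push(1)[OF inj_append_left, of \<alpha> x "drop (length \<alpha>) \<gamma>"] by (simp add: word_op_creation)
next
  case False
  then have "\<gamma> \<notin> range ((@) \<alpha>)" by auto
  then show ?thesis
    using False by (simp add: word_op_creation coord_push(2)[OF inj_append_left])
qed

lemma finite_words: "finite {\<alpha> :: 'n::finite list. length \<alpha> = k}"
  using finite_lists_length_eq[of "UNIV :: 'n set" k] by simp

lemma disjoint_words: "disjoint_family_on (\<lambda>\<alpha>. range ((@) \<alpha>)) {\<alpha>. length \<alpha> = k}"
  by (auto simp: disjoint_family_on_def)

section \<open>The creation operators satisfy the standing assumptions on row contractions\<close>

lemma row_contraction_creation: "row_contraction creation"
  unfolding row_contraction_def
proof (intro conjI allI bounded_clinear_creation)
  fix h :: "'a fock"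
  have "cinner (\<Sum>i\<in>UNIV. creation i (cadjoint (creation i) h)) h = (\<Sum>i\<in>UNIV. cinner (creation i (cadjoint (creation i) h)) h)"
    by (rule linear_sum[OF bounded_linear.linear[OF bounded_linear_cinner_left]])
  also have "Re \<dots> = (\<Sum>i\<in>UNIV. (norm (pull ((#) i) h))\<^sup>2)"
    by (simp add: cinner_creation cadjoint_creation cinner_self)
  also have "\<dots> = (\<Sum>\<^sub>\<infinity>\<gamma>\<in>(\<Union>i. range ((#) i)). (cmod (coord h \<gamma>))\<^sup>2)"
    by (intro sum_norm_pull_square) (auto simp: inj_def disjoint_family_on_def)
  also have "\<dots> \<le> (\<Sum>\<^sub>\<infinity>\<gamma>. (cmod (coord h \<gamma>))\<^sup>2)"
    by (intro infsum_mono_neutral coord_summable summable_on_subset_banach[OF coord_summable]) auto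
  also have "\<dots> = Re (cinner h h)"
    by (simp add: cinner_self norm_ell2_square)
  finally show "Re (cinner (\<Sum>i\<in>UNIV. creation i (cadjoint (creation i) h)) h) \<le> Re (cinner h h)" .
qed

lemma completely_non_coisometric_creation: "completely_non_coisometric creation"
  unfolding completely_non_coisometric_def
proof (rule notI, elim exE conjE)
  fix h :: "'a fock"
  assume "h \<noteq> 0"
    and eq: "\<forall>k\<ge>1. (\<Sum>\<alpha> | length \<alpha> = k. (norm (cadjoint (word_op creation \<alpha>) h))\<^sup>2) = (norm h)\<^sup>2"
  have "coord h \<gamma> = 0" for \<gamma>
  proof -
    \<comment> \<open>At level \<open>Suc (length \<gamma>)\<close> the sum of squares only counts
      words strictly longer than \<open>\<gamma>\<close>. If it still equals the full norm, the
      coordinate at \<open>\<gamma>\<close> must vanish.\<close>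
    let ?k = "Suc (length \<gamma>)" and ?f = "\<lambda>\<gamma>. (cmod (coord h \<gamma>))\<^sup>2"
    define U where "U = (\<Union>\<alpha>\<in>{\<alpha> :: 'a list. length \<alpha> = ?k}. range ((@) \<alpha>))"
    have sm: "?f summable_on A" for A
      by (rule summable_on_subset_banach[OF coord_summable]) simp
    have notin: "\<gamma> \<notin> U"
    proof
      assume "\<gamma> \<in> U"
      then obtain \<alpha> \<delta> where "length \<alpha> = ?k" "\<gamma> = \<alpha> @ \<delta>" unfolding U_def by blast
      then show False by simp
    qed
    have "(norm h)\<^sup>2 = (\<Sum>\<alpha> | length \<alpha> = ?k. (norm (pull ((@) \<alpha>) h))\<^sup>2)"
      using eq by (simp add: word_op_creation cadjoint_push inj_append_left)
    also have "\<dots> = infsum ?f U"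
      unfolding U_def by (intro sum_norm_pull_square finite_words disjoint_words inj_append_left)
    finally have U: "(norm h)\<^sup>2 = infsum ?f U" .
    have "infsum ?f U + ?f \<gamma> = infsum ?f (U \<union> {\<gamma>})"
      using infsum_Un_disjoint[OF sm sm, of U "{\<gamma>}"] notin by (simp add: disjoint_iff)
    also have "\<dots> \<le> infsum ?f UNIV"
      by (intro infsum_mono_neutral sm) auto
    also have "\<dots> = infsum ?f U"
      using U by (simp only: norm_ell2_square)
    finally show ?thesis by simp
  qed
  then have "h = 0" by (intro ell2_eqI) (simp add: coord_simps)
  with \<open>h \<noteq> 0\<close> show False by simp
qed

section \<open>Properties that \<open>F_infty\<close> inherits from its generators\<close>

lemma F_infty_subset:
  assumes "operator_algebra A" "closedin wot A" "id \<in> A" "\<And>i. creation i \<in> A"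
  shows "F_infty \<subseteq> A"
  unfolding F_infty_def wot_closed_algebra_generated_def
  by (rule hull_minimal) (use assms in auto)

lemma creation_in_F_infty: "creation i \<in> F_infty"
  unfolding F_infty_def wot_closed_algebra_generated_def by (rule hull_inc) simp

text \<open>Bounded operators commuting with all right creation operators form a WOT-closed algebra,
  and it contains the generators because prepending and appending letters commute. Minimality of the
  hull does the rest.\<close>

lemma F_infty_commutes_right_creation:
  fixes \<phi> :: "'n::finite fock \<Rightarrow> 'n fock"
  assumes "\<phi> \<in> F_infty"
  shows "bounded_clinear \<phi>" and "\<phi> (push (\<lambda>\<alpha>. \<alpha> @ \<beta>) x) = push (\<lambda>\<alpha>. \<alpha> @ \<beta>) (\<phi> x)"
proof -
  let ?R = "\<lambda>\<beta>. push (\<lambda>\<alpha>::'n list. \<alpha> @ \<beta>)" and ?R' = "\<lambda>\<beta>. pull (\<lambda>\<alpha>::'n list. \<alpha> @ \<beta>)"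
  define A where "A = {T :: 'n fock \<Rightarrow> 'n fock. bounded_clinear T \<and> (\<forall>\<beta> x. T (?R \<beta> x) = ?R \<beta> (T x))}"
  \<comment> \<open>Moving the outer right creation operator to the second argument, as its adjoint
    \<open>?R'\<close>, turns commutation into equality of two coefficients of
    \<open>T\<close>.\<close>
  define Q where "Q = (\<lambda>(\<beta>, x, y). (?R \<beta> x, y, x, ?R' \<beta> y)) ` UNIV"
  have "T (?R \<beta> x) = ?R \<beta> (T x) \<longleftrightarrow> (\<forall>y. cinner (T (?R \<beta> x)) y = cinner (T x) (?R' \<beta> y))" for T \<beta> x
    using cinner_eqI[of "T (?R \<beta> x)"] by (auto simp: cinner_push[OF inj_append_right, symmetric])
  then have "A = {T. bounded_clinear T \<and> (\<forall>(x, y, u, v)\<in>Q. cinner (T x) y = cinner (T u) v)}"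
    by (auto simp: A_def Q_def)
  then have "closedin wot A"
    by (simp only: closedin_wot_cinner_eq)
  moreover have "operator_algebra A"
    by (auto simp: bounded_clinearD[OF bounded_clinear_push] operator_algebra_def A_def bounded_clinear_zero bounded_clinear_add bounded_clinear_scaleC
        bounded_clinear_comp bounded_clinearD)
  moreover have "creation i \<in> A" for i
    unfolding A_def mem_Collect_eq
  proof (intro conjI allI bounded_clinear_creation)
    have "creation i (?R \<beta> (ket \<gamma>)) = ?R \<beta> (creation i (ket \<gamma>))" for \<beta> \<gamma>
      by (simp add: push_ket inj_append_right creation_ket)
    moreover have "closed_csubspace {x. creation i (?R \<beta> x) = ?R \<beta> (creation i x)}" for \<beta>
      unfolding closed_csubspace_def
    proof (intro conjI)
      show "closed {x. creation i (?R \<beta> x) = ?R \<beta> (creation i x)}"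
        by (intro closed_Collect_eq linear_continuous_on bounded_linear_compose[OF bounded_linear_push]
            bounded_linear_compose[OF bounded_clinearD(1)[OF bounded_clinear_creation]]
            bounded_clinearD(1)[OF bounded_clinear_creation] bounded_linear_push)
    qed (auto simp: bounded_clinearD[OF bounded_clinear_creation] bounded_clinearD[OF bounded_clinear_push])
    ultimately show "creation i (?R \<beta> x) = ?R \<beta> (creation i x)" for \<beta> x
      using closed_csubspace_UNIV_if_ket[of "{x. creation i (?R \<beta> x) = ?R \<beta> (creation i x)}"] by blast
  qed
  moreover have "id \<in> A"
    by (simp add: A_def bounded_clinear_id)
  ultimately have "\<phi> \<in> A"
    using F_infty_subset assms by blast
  then show "bounded_clinear \<phi>" "\<phi> (?R \<beta> x) = ?R \<beta> (\<phi> x)"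
    by (auto simp: A_def)
qed

lemma F_infty_ket:
  assumes "\<phi> \<in> F_infty"
  shows "\<phi> (ket \<beta>) = push (\<lambda>\<alpha>. \<alpha> @ \<beta>) (\<phi> (ket []))"
  using F_infty_commutes_right_creation(2)[OF assms, of \<beta> "ket []"] by (simp add: push_ket inj_append_right)

text \<open>Taking adjoints, co-invariance of \<open>M\<close> says that each creation operator
  preserves the complement of \<open>M\<close>, and the bounded operators preserving it form a
  WOT-closed algebra.\<close>

lemma F_infty_orth_compl:
  assumes M: "\<And>i. cadjoint (creation i) ` M \<subseteq> M" and \<phi>: "\<phi> \<in> F_infty" and x: "x \<in> orth_compl M"
  shows "\<phi> x \<in> orth_compl M"
proof -
  define A where "A = {T. bounded_clinear T \<and> (\<forall>x\<in>orth_compl M. T x \<in> orth_compl M)}"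
  \<comment> \<open>The pair \<open>(0, 0)\<close> on the right-hand side encodes the vanishing of
    the coefficient at \<open>(x, y)\<close>.\<close>
  have "A = {T. bounded_clinear T \<and> (\<forall>(x, y, u, v)\<in>{(x, y, 0, 0) | x y. x \<in> orth_compl M \<and> y \<in> M}.
      cinner (T x) y = cinner (T u) v)}"
    by (auto simp: A_def orth_compl_def[of M] cinner_linear_simps)
  then have "closedin wot A"
    by (simp only: closedin_wot_cinner_eq)
  moreover have "operator_algebra A"
    using closed_csubspaceD[OF closed_csubspace_orth_compl[of M]]
    by (auto simp: operator_algebra_def A_def bounded_clinear_zero bounded_clinear_add bounded_clinear_scaleC
        bounded_clinear_comp)
  moreover have "creation i \<in> A" for i
    using M by (auto simp: A_def bounded_clinear_creation orth_compl_def cinner_creation)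
  moreover have "id \<in> A"
    by (simp add: A_def bounded_clinear_id)
  ultimately have "\<phi> \<in> A"
    using F_infty_subset \<phi> by blast
  then show ?thesis using x by (simp add: A_def)
qed

text \<open>Only the cut of \<open>\<gamma>\<close> whose tail is \<open>\<beta>\<close>
  contributes. Writing the coordinate as a convolution with \<open>ket \<beta>\<close> gives a
  formula that extends linearly to arbitrary vectors.\<close>

lemma coord_push_append_right:
  "coord (push (\<lambda>\<alpha>. \<alpha> @ \<beta>) f) \<gamma> = (\<Sum>k\<le>length \<gamma>. coord f (take k \<gamma>) * coord (ket \<beta>) (drop k \<gamma>))"
proof (cases "\<gamma> \<in> range (\<lambda>\<alpha>. \<alpha> @ \<beta>)")
  case True
  then obtain \<alpha> where \<alpha>: "\<gamma> = \<alpha> @ \<beta>" by blast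
  have "(\<Sum>k\<le>length \<gamma>. coord f (take k \<gamma>) * coord (ket \<beta>) (drop k \<gamma>))
      = (\<Sum>k\<in>{length \<alpha>}. coord f (take k \<gamma>) * coord (ket \<beta>) (drop k \<gamma>))"
  proof (rule sum.mono_neutral_right)
    have "drop k \<gamma> \<noteq> \<beta>" if "k \<le> length \<gamma>" "k \<noteq> length \<alpha>" for k
    proof
      assume "drop k \<gamma> = \<beta>"
      then have "length \<gamma> - k = length \<beta>" by (metis length_drop)
      then show False using that by (simp add: \<alpha>)
    qed
    then show "\<forall>k\<in>{..length \<gamma>} - {length \<alpha>}. coord f (take k \<gamma>) * coord (ket \<beta>) (drop k \<gamma>) = 0"
      by (auto simp: coord_simps)
  qed (auto simp: \<alpha>)
  then show ?thesis
    using coord_push(1)[OF inj_append_right, of \<beta> f \<alpha>] by (simp add: \<alpha> coord_simps)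
next
  case False
  have "drop k \<gamma> \<noteq> \<beta>" for k
    using False append_take_drop_id[of k \<gamma>] by (metis rangeI)
  then show ?thesis
    by (simp add: coord_push(2)[OF inj_append_right False] coord_simps)
qed

text \<open>\<open>\<phi>\<close> acts as left multiplication \<open>x \<mapsto> \<phi>(1) \<otimes> x\<close>, since it does so on the basis.\<close>

lemma coord_F_infty:
  assumes \<phi>: "\<phi> \<in> F_infty"
  shows "coord (\<phi> x) \<gamma> = (\<Sum>k\<le>length \<gamma>. coord (\<phi> (ket [])) (take k \<gamma>) * coord x (drop k \<gamma>))"
proof -
  let ?g = "\<lambda>x. \<Sum>k\<le>length \<gamma>. coord (\<phi> (ket [])) (take k \<gamma>) * coord x (drop k \<gamma>)"
  note bc = F_infty_commutes_right_creation(1)[OF \<phi>]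
  have "closed_csubspace {x. coord (\<phi> x) \<gamma> = ?g x}"
    unfolding closed_csubspace_def
  proof (intro conjI)
    show "closed {x. coord (\<phi> x) \<gamma> = ?g x}"
      by (intro closed_Collect_eq linear_continuous_on bounded_linear_compose[OF bounded_linear_coord]
          bounded_clinearD(1)[OF bc] bounded_linear_sum bounded_linear_const_mult bounded_linear_coord)
  qed (auto simp: bounded_clinearD[OF bc] coord_simps algebra_simps sum.distrib sum_distrib_left)
  moreover have "coord (\<phi> (ket \<beta>)) \<gamma> = ?g (ket \<beta>)" for \<beta>
    unfolding F_infty_ket[OF \<phi>, of \<beta>] by (rule coord_push_append_right)
  ultimately show ?thesis
    using closed_csubspace_UNIV_if_ket[of "{x. coord (\<phi> x) \<gamma> = ?g x}"] by blast
qed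

section \<open>Dilations and the functional calculus\<close>

text \<open>A triangular factor of the matrix with entries \<open>r ^ \<bar>m - l\<bar>\<close>: for
  \<open>0 \<le> r \<le> 1\<close> its products summed over \<open>j\<close> give these entries. The
  weight \<open>sqrt (1 - r\<^sup>2)\<close> makes the squares over \<open>j\<close> sum to 1 for
  each \<open>m\<close>.\<close>

definition schur :: "real \<Rightarrow> nat \<Rightarrow> nat \<Rightarrow> real" where
  "schur r j m = (if m < j then 0 else (if j = 0 then 1 else sqrt (1 - r\<^sup>2)) * r ^ (m - j))"

lemma schur_sum:
  assumes "0 \<le> r" "r \<le> 1"
  shows "(\<Sum>j\<le>m. schur r j m * schur r j (m + d)) = r ^ d"
proof (induction m)
  case 0
  then show ?case by (simp add: schur_def)
next
  case (Suc m)
  \<comment> \<open>Raising \<open>m\<close> by one scales every old product by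
    \<open>r\<^sup>2\<close>, and the new index \<open>Suc m\<close> supplies the missing
    \<open>(1 - r\<^sup>2) * r ^ d\<close>.\<close>
  have "schur r j (Suc m) * schur r j (Suc m + d) = r\<^sup>2 * (schur r j m * schur r j (m + d))" if "j \<le> m" for j
    using that by (simp add: schur_def Suc_diff_le power2_eq_square)
  then have "(\<Sum>j\<le>m. schur r j (Suc m) * schur r j (Suc m + d)) = r\<^sup>2 * r ^ d"
    by (simp add: Suc flip: sum_distrib_left)
  moreover have "r\<^sup>2 \<le> 1" using assms by (simp add: power_le_one)
  ultimately show ?case
    by (simp add: schur_def algebra_simps)
qed

text \<open>Terms with \<open>j > m\<close> vanish, so a single cutoff \<open>N\<close> can serve
  all words of a finite set at once.\<close>

lemma schur_sum_le:
  assumes "0 \<le> r" "r \<le> 1" "m \<le> N"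
  shows "(\<Sum>j\<le>N. schur r j m * schur r j (m + d)) = r ^ d"
  unfolding schur_sum[OF assms(1,2), of m d, symmetric]
  by (rule sum.mono_neutral_right) (use assms in \<open>auto simp: schur_def\<close>)

lemma schur_sum_square_le_1:
  assumes "0 \<le> r" "r \<le> 1"
  shows "(\<Sum>j\<le>N. (schur r j m)\<^sup>2) \<le> 1"
proof -
  have "(\<Sum>j\<le>N. (schur r j m)\<^sup>2) \<le> (\<Sum>j\<le>max N m. (schur r j m)\<^sup>2)"
    by (rule sum_mono2) auto
  also have "\<dots> = 1"
    using schur_sum_le[OF assms, of m "max N m" 0] by (simp add: power2_eq_square)
  finally show ?thesis .
qed

lemma abs_schur_le_1:
  assumes "0 \<le> r" "r \<le> 1"
  shows "\<bar>schur r j m\<bar> \<le> 1"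
proof -
  have "(schur r j m)\<^sup>2 \<le> (\<Sum>i\<le>j. (schur r i m)\<^sup>2)"
    by (rule member_le_sum) auto
  also have "\<dots> \<le> 1" by (rule schur_sum_square_le_1[OF assms])
  finally show ?thesis by (simp add: abs_square_le_1)
qed

text \<open>The sum has the form \<open>C* (\<phi> \<oplus> ... \<oplus> \<phi>) C\<close>, where
  the column \<open>C\<close> of diagonal operators is a contraction. The bound follows by pairing
  the sum with itself and applying Cauchy-Schwarz, first in each summand and then over
  \<open>I\<close>.\<close>

lemma norm_sum_diag_conj_le:
  fixes x :: "'i ell2"
  assumes I: "finite I" and c: "\<And>j i. \<bar>c j i\<bar> \<le> 1" and le: "\<And>i. (\<Sum>j\<in>I. (c j i)\<^sup>2) \<le> 1"
    and K: "0 \<le> K" "\<And>x. norm (\<phi> x) \<le> K * norm x"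
  shows "norm (\<Sum>j\<in>I. diag (c j) (\<phi> (diag (c j) x))) \<le> K * norm x"
proof -
  define y where "y = (\<Sum>j\<in>I. diag (c j) (\<phi> (diag (c j) x)))"
  have L2: "L2_set (\<lambda>j. norm (diag (c j) u)) I \<le> norm u" for u :: "'i ell2"
    unfolding L2_set_def using sum_norm_diag_square_le[OF I c le, where x = u]
    by (intro real_le_lsqrt) (auto simp: sum_nonneg)
  have "(norm y)\<^sup>2 = (\<Sum>j\<in>I. inner (diag (c j) (\<phi> (diag (c j) x))) y)"
    by (simp add: power2_norm_eq_inner y_def inner_sum_left)
  also have "\<dots> = (\<Sum>j\<in>I. inner (\<phi> (diag (c j) x)) (diag (c j) y))"
    by (simp add: cinner_diag flip: Re_cinner)
  \<comment> \<open>The absolute values around the norms match the form of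
    \<open>L2_set_mult_ineq\<close>.\<close>
  also have "\<dots> \<le> (\<Sum>j\<in>I. K * (\<bar>norm (diag (c j) x)\<bar> * \<bar>norm (diag (c j) y)\<bar>))"
  proof (rule sum_mono)
    fix j
    have "inner (\<phi> (diag (c j) x)) (diag (c j) y) \<le> norm (\<phi> (diag (c j) x)) * norm (diag (c j) y)"
      by (rule norm_cauchy_schwarz)
    also have "\<dots> \<le> (K * norm (diag (c j) x)) * norm (diag (c j) y)"
      by (intro mult_right_mono K) simp
    finally show "inner (\<phi> (diag (c j) x)) (diag (c j) y)
        \<le> K * (\<bar>norm (diag (c j) x)\<bar> * \<bar>norm (diag (c j) y)\<bar>)"
      by (simp add: mult.assoc)
  qed
  also have "\<dots> \<le> K * (L2_set (\<lambda>j. norm (diag (c j) x)) I * L2_set (\<lambda>j. norm (diag (c j) y)) I)"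
    unfolding sum_distrib_left[symmetric] by (intro mult_left_mono L2_set_mult_ineq K)
  also have "\<dots> \<le> K * (norm x * norm y)"
    by (intro mult_left_mono mult_mono L2 K) auto
  finally have "norm y * norm y \<le> (K * norm x) * norm y"
    by (simp add: power2_eq_square mult.assoc)
  then have "norm y \<le> K * norm x"
    using K(1) by (cases "norm y = 0") (auto dest: mult_right_le_imp_le)
  then show ?thesis by (simp add: y_def)
qed

section \<open>Dilations of left multiplication operators\<close>

definition toeplitz_term :: "'n::finite fock \<Rightarrow> real \<Rightarrow> 'n fock \<Rightarrow> nat \<Rightarrow> 'n fock" where
  "toeplitz_term f r h k =
     (\<Sum>\<alpha> | length \<alpha> = k. (complex_of_real (r ^ length \<alpha>) * coord f \<alpha>) *\<^sub>C word_op creation \<alpha> h)"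

text \<open>With \<open>f = \<phi> (ket [])\<close> this is the dilation
  \<open>\<phi>\<^sub>r\<close>: the series inside the limit of \<open>has_fcalculus\<close>,
  evaluated at the creation operators themselves.\<close>

definition toeplitz :: "'n::finite fock \<Rightarrow> real \<Rightarrow> 'n fock \<Rightarrow> 'n fock" where
  "toeplitz f r h = (\<Sum>k. toeplitz_term f r h k)"

lemma coord_toeplitz_term:
  "coord (toeplitz_term f r h k) \<gamma> =
     (if k \<le> length \<gamma> then complex_of_real (r ^ k) * coord f (take k \<gamma>) * coord h (drop k \<gamma>) else 0)"
proof -
  let ?t = "complex_of_real (r ^ k) * coord f (take k \<gamma>) * coord h (drop k \<gamma>)"
  have "coord (toeplitz_term f r h k) \<gamma> = (\<Sum>\<alpha> | length \<alpha> = k. if \<alpha> = take k \<gamma> then ?t else 0)"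
    unfolding toeplitz_term_def coord_sum
  proof (intro sum.cong refl)
    fix \<alpha> :: "'a list" assume "\<alpha> \<in> {\<alpha>. length \<alpha> = k}"
    then have "length \<alpha> = k" by simp
    then show "coord ((complex_of_real (r ^ length \<alpha>) * coord f \<alpha>) *\<^sub>C word_op creation \<alpha> h) \<gamma>
        = (if \<alpha> = take k \<gamma> then ?t else 0)"
      by (cases "\<alpha> = take k \<gamma>") (simp_all add: coord_simps coord_word_op_creation del: length_take)
  qed
  also have "\<dots> = (if take k \<gamma> \<in> {\<alpha>. length \<alpha> = k} then ?t else 0)"
    by (rule sum.delta[OF finite_words])
  finally show ?thesis by (auto simp: min_def)
qed

text \<open>Distinct words of equal length give isometries with orthogonal ranges, so Pythagoras
  applies. The geometric factor yields norm convergence of the series for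
  \<open>r < 1\<close>.\<close>

lemma norm_toeplitz_term_le:
  assumes "0 \<le> r"
  shows "norm (toeplitz_term f r h k) \<le> r ^ k * (norm f * norm h)"
proof -
  have "pairwise (\<lambda>\<alpha> \<beta>. orthogonal ((complex_of_real (r ^ length \<alpha>) * coord f \<alpha>) *\<^sub>C word_op creation \<alpha> h)
      ((complex_of_real (r ^ length \<beta>) * coord f \<beta>) *\<^sub>C word_op creation \<beta> h)) {\<alpha>. length \<alpha> = k}"
    using disjoint_words[of k]
    by (auto simp: pairwise_def orthogonal_def word_op_creation cinner_linear_simps cinner_push_orthogonal
        inj_append_left disjoint_family_on_def simp flip: Re_cinner)
  then have "(norm (toeplitz_term f r h k))\<^sup>2
      = (\<Sum>\<alpha> | length \<alpha> = k. (norm ((complex_of_real (r ^ length \<alpha>) * coord f \<alpha>) *\<^sub>C word_op creation \<alpha> h))\<^sup>2)"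
    unfolding toeplitz_term_def by (rule norm_sum_Pythagorean[OF finite_words])
  also have "\<dots> = (\<Sum>\<alpha> | length \<alpha> = k. (r ^ k * norm h)\<^sup>2 * (cmod (coord f \<alpha>))\<^sup>2)"
    using assms by (intro sum.cong)
      (auto simp: norm_scaleC norm_mult norm_power word_op_creation norm_push inj_append_left power_mult_distrib)
  also have "\<dots> \<le> (r ^ k * norm h)\<^sup>2 * (norm f)\<^sup>2"
    unfolding sum_distrib_left[symmetric] by (intro mult_left_mono sum_coord_le_norm finite_words) simp
  also have "\<dots> = (r ^ k * (norm f * norm h))\<^sup>2"
    by (simp add: power_mult_distrib)
  finally show ?thesis
    by (rule power2_le_imp_le) (use assms in simp)
qed

lemma summable_toeplitz_term:
  assumes "0 \<le> r" "r < 1"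
  shows "summable (toeplitz_term f r h)"
proof (rule summable_comparison_test')
  show "summable (\<lambda>k. r ^ k * (norm f * norm h))"
    using assms by (intro summable_mult2 summable_geometric) simp
  show "norm (toeplitz_term f r h k) \<le> r ^ k * (norm f * norm h)" for k
    using assms(1) by (rule norm_toeplitz_term_le)
qed

text \<open>The coordinate at \<open>\<gamma>\<close> only sees prefixes of \<open>\<gamma>\<close>,
  so the series is finite there.\<close>

lemma coord_toeplitz:
  assumes "0 \<le> r" "r < 1"
  shows "coord (toeplitz f r h) \<gamma> =
    (\<Sum>k\<le>length \<gamma>. complex_of_real (r ^ k) * coord f (take k \<gamma>) * coord h (drop k \<gamma>))"
proof -
  have "coord (toeplitz f r h) \<gamma> = (\<Sum>k. coord (toeplitz_term f r h k) \<gamma>)"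
    unfolding toeplitz_def
    by (rule bounded_linear.suminf[OF bounded_linear_coord summable_toeplitz_term[OF assms]])
  also have "\<dots> = (\<Sum>k\<le>length \<gamma>. coord (toeplitz_term f r h k) \<gamma>)"
    by (rule suminf_finite) (auto simp: coord_toeplitz_term)
  finally show ?thesis by (simp add: coord_toeplitz_term)
qed

text \<open>
  The dilation \<open>\<phi>\<^sub>r\<close> multiplies the matrix entry of \<open>\<phi>\<close> at \<open>(\<gamma>, \<beta>)\<close> by \<open>r ^ (|\<gamma>| - |\<beta>|)\<close>. By
  \<open>schur_sum\<close> this is a sum of rank-one Schur multipliers.
\<close>

lemma norm_toeplitz_le:
  assumes \<phi>: "\<phi> \<in> F_infty" and r: "0 \<le> r" "r < 1" and K: "0 \<le> K" "\<And>x. norm (\<phi> x) \<le> K * norm x"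
  shows "norm (toeplitz (\<phi> (ket [])) r x) \<le> K * norm x"
proof -
  let ?a = "\<lambda>\<alpha>. coord (\<phi> (ket [])) \<alpha>" and ?c = "\<lambda>j \<gamma>. schur r j (length \<gamma>)"
  have r': "r \<le> 1" using r by simp
  note c1 = abs_schur_le_1[OF r(1) r']
  have "(\<Sum>\<gamma>\<in>F. (cmod (coord (toeplitz (\<phi> (ket [])) r x) \<gamma>))\<^sup>2) \<le> (K * norm x)\<^sup>2" if "finite F" for F
  proof -
    \<comment> \<open>On the finite set \<open>F\<close> the dilation agrees with a finite sum
      \<open>y\<close> of conjugates of \<open>\<phi>\<close> by diagonal operators. The cutoff
      \<open>N\<close> depends on \<open>F\<close>, but the resulting bound does not.\<close>
    obtain N where N: "\<And>\<gamma>. \<gamma> \<in> F \<Longrightarrow> length \<gamma> \<le> N"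
      using finite_nat_set_iff_bounded_le[of "length ` F"] \<open>finite F\<close> by auto
    define y where "y = (\<Sum>j\<le>N. diag (?c j) (\<phi> (diag (?c j) x)))"
    have "coord (toeplitz (\<phi> (ket [])) r x) \<gamma> = coord y \<gamma>" if "\<gamma> \<in> F" for \<gamma>
    proof -
      have "coord y \<gamma> = (\<Sum>j\<le>N. complex_of_real (?c j \<gamma>) *
          (\<Sum>k\<le>length \<gamma>. ?a (take k \<gamma>) * (complex_of_real (?c j (drop k \<gamma>)) * coord x (drop k \<gamma>))))"
        by (simp add: y_def coord_sum coord_diag c1 coord_F_infty[OF \<phi>, of "diag _ _"])
      also have "\<dots> = (\<Sum>k\<le>length \<gamma>. complex_of_real (\<Sum>j\<le>N. ?c j (drop k \<gamma>) * ?c j \<gamma>) *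
          ?a (take k \<gamma>) * coord x (drop k \<gamma>))"
        unfolding of_real_sum sum_distrib_left sum_distrib_right
        by (subst sum.swap) (simp add: mult_ac)
      also have "\<dots> = (\<Sum>k\<le>length \<gamma>. complex_of_real (r ^ k) * ?a (take k \<gamma>) * coord x (drop k \<gamma>))"
      proof (intro sum.cong refl)
        fix k assume "k \<in> {..length \<gamma>}"
        then have "(\<Sum>j\<le>N. ?c j (drop k \<gamma>) * ?c j \<gamma>) = r ^ k"
          using schur_sum_le[OF r(1) r', of "length \<gamma> - k" N k] N[OF that] by simp
        then show "complex_of_real (\<Sum>j\<le>N. ?c j (drop k \<gamma>) * ?c j \<gamma>) * ?a (take k \<gamma>) * coord x (drop k \<gamma>)
          = complex_of_real (r ^ k) * ?a (take k \<gamma>) * coord x (drop k \<gamma>)" by simp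
      qed
      finally show ?thesis by (simp add: coord_toeplitz r)
    qed
    then have "(\<Sum>\<gamma>\<in>F. (cmod (coord (toeplitz (\<phi> (ket [])) r x) \<gamma>))\<^sup>2) = (\<Sum>\<gamma>\<in>F. (cmod (coord y \<gamma>))\<^sup>2)"
      by simp
    also have "\<dots> \<le> (norm y)\<^sup>2"
      using \<open>finite F\<close> by (rule sum_coord_le_norm)
    also have "\<dots> \<le> (K * norm x)\<^sup>2"
      unfolding y_def by (intro power_mono norm_sum_diag_conj_le c1 schur_sum_square_le_1 r r' K) simp_all
    finally show ?thesis .
  qed
  then have "(norm (toeplitz (\<phi> (ket [])) r x))\<^sup>2 \<le> (K * norm x)\<^sup>2"
    unfolding norm_ell2_square by (intro infsum_le_finite_sums coord_summable)
  then show ?thesis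
    by (rule power2_le_imp_le) (use K in simp)
qed

lemma eventually_at_left_1: "\<forall>\<^sub>F r :: real in at_left 1. 0 \<le> r \<and> r < 1"
  by (rule eventually_mono[OF eventually_at_left_real[of 0]]) auto

text \<open>Applied to \<open>\<phi> (ket [])\<close>, this gives convergence of the dilations on
  basis vectors: their value at \<open>ket \<beta>\<close> is the dilated vector with
  \<open>\<beta>\<close> appended to its words.\<close>

lemma tendsto_diag_power:
  "((\<lambda>r::real. diag (\<lambda>\<alpha>. r ^ length \<alpha>) f) \<longlongrightarrow> f) (at_left 1)"
proof (rule tendsto_of_tendsto_ket[where L = "\<lambda>r. diag (\<lambda>\<alpha>. r ^ length \<alpha>)" and G = "\<lambda>x. x" and K = 1 and x = f])
  show "\<forall>\<^sub>F r in at_left 1. (\<forall>x y. diag (\<lambda>\<alpha>. r ^ length \<alpha>) (x + y) = diag (\<lambda>\<alpha>. r ^ length \<alpha>) x + diag (\<lambda>\<alpha>. r ^ length \<alpha>) y) \<and>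
      (\<forall>c x. diag (\<lambda>\<alpha>. r ^ length \<alpha>) (c *\<^sub>C x) = c *\<^sub>C diag (\<lambda>\<alpha>. r ^ length \<alpha>) x) \<and>
      (\<forall>x. norm (diag (\<lambda>\<alpha>::'a list. r ^ length \<alpha>) x) \<le> 1 * norm x)"
    using eventually_at_left_1
    by eventually_elim (simp add: diag_add diag_scaleC norm_diag_le power_le_one)
  show "((\<lambda>r::real. diag (\<lambda>\<alpha>. r ^ length \<alpha>) (ket \<beta>)) \<longlongrightarrow> ket \<beta>) (at_left 1)" for \<beta> :: "'a list"
  proof -
    have "((\<lambda>r::real. r ^ length \<beta> *\<^sub>R ket \<beta>) \<longlongrightarrow> 1 ^ length \<beta> *\<^sub>R ket \<beta>) (at_left 1)"
      by (intro tendsto_intros)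
    moreover have "\<forall>\<^sub>F r::real in at_left 1. r ^ length \<beta> *\<^sub>R ket \<beta> = diag (\<lambda>\<alpha>. r ^ length \<alpha>) (ket \<beta>)"
      using eventually_at_left_1
      by eventually_elim (simp add: diag_ket power_le_one scaleR_scaleC)
    ultimately show ?thesis
      by (simp add: tendsto_cong)
  qed
qed auto

text \<open>Convergence on basis vectors extends to every \<open>h\<close> because
  \<open>norm_toeplitz_le\<close> bounds all dilations by one constant \<open>K\<close>, a bound for
  \<open>\<phi>\<close> itself.\<close>

lemma tendsto_toeplitz:
  assumes \<phi>: "\<phi> \<in> F_infty"
  shows "((\<lambda>r. toeplitz (\<phi> (ket [])) r h) \<longlongrightarrow> \<phi> h) (at_left 1)"
proof -
  note bc = F_infty_commutes_right_creation(1)[OF \<phi>]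
  obtain K where K: "K > 0" "\<And>x. norm (\<phi> x) \<le> K * norm x"
    using bounded_linear.pos_bounded[OF bounded_clinearD(1)[OF bc]] by (metis mult.commute)
  show ?thesis
  proof (rule tendsto_of_tendsto_ket[where K = K and L = "toeplitz (\<phi> (ket []))" and x = h and G = \<phi>])
    show "\<forall>\<^sub>F r in at_left 1.
        (\<forall>x y. toeplitz (\<phi> (ket [])) r (x + y) = toeplitz (\<phi> (ket [])) r x + toeplitz (\<phi> (ket [])) r y) \<and>
        (\<forall>c x. toeplitz (\<phi> (ket [])) r (c *\<^sub>C x) = c *\<^sub>C toeplitz (\<phi> (ket [])) r x) \<and>
        (\<forall>x. norm (toeplitz (\<phi> (ket [])) r x) \<le> K * norm x)"
      using eventually_at_left_1
    proof eventually_elim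
      case (elim r)
      then have r: "0 \<le> r" "r < 1" by auto
      show ?case
        using norm_toeplitz_le[OF \<phi> r _ K(2)] K(1)
        by (auto intro!: ell2_eqI simp: coord_toeplitz[OF r] coord_simps algebra_simps sum.distrib sum_distrib_left)
    qed
    show "((\<lambda>r. toeplitz (\<phi> (ket [])) r (ket \<beta>)) \<longlongrightarrow> \<phi> (ket \<beta>)) (at_left 1)" for \<beta>
    proof -
      have "((\<lambda>r::real. push (\<lambda>\<alpha>. \<alpha> @ \<beta>) (diag (\<lambda>\<alpha>. r ^ length \<alpha>) (\<phi> (ket [])))) \<longlongrightarrow> \<phi> (ket \<beta>)) (at_left 1)"
        unfolding F_infty_ket[OF \<phi>, of \<beta>]
        by (intro bounded_linear.tendsto[OF bounded_linear_push] tendsto_diag_power)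
      moreover have "\<forall>\<^sub>F r::real in at_left 1.
          push (\<lambda>\<alpha>. \<alpha> @ \<beta>) (diag (\<lambda>\<alpha>. r ^ length \<alpha>) (\<phi> (ket []))) = toeplitz (\<phi> (ket [])) r (ket \<beta>)"
        using eventually_at_left_1
      proof eventually_elim
        case (elim r)
        then show ?case
          by (intro ell2_eqI) (simp add: coord_push_append_right coord_toeplitz coord_diag power_le_one)
      qed
      ultimately show ?thesis
        by (simp add: tendsto_cong)
    qed
  qed (simp_all add: bounded_clinearD[OF bc])
qed

section \<open>Functional calculus of compressions to co-invariant subspaces\<close>

lemma word_op_compression:
  fixes M :: "'n::finite fock set"
  assumes M: "closed_csubspace M" and inv: "\<And>i. cadjoint (creation i) ` M \<subseteq> M" and h: "h \<in> M"
  shows "word_op (\<lambda>i. compression M (creation i)) \<alpha> h = orth_proj M (word_op creation \<alpha> h)"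
proof (induction \<alpha>)
  case Nil
  then show ?case by (simp add: word_op_simps orth_proj_of_mem M h)
next
  case (Cons i \<alpha>)
  let ?w = "word_op creation \<alpha> h"
  \<comment> \<open>The part of \<open>?w\<close> removed by the projection stays in the complement
    of \<open>M\<close> under \<open>creation i\<close>, so projecting at every step or only at the
    end gives the same vector.\<close>
  have "creation i (?w - orth_proj M ?w) \<in> orth_compl M"
    by (rule F_infty_orth_compl[OF inv creation_in_F_infty diff_orth_proj[OF M]])
  then have "orth_proj M (creation i ?w - creation i (orth_proj M ?w)) = 0"
    by (simp add: orth_proj_eq_0_iff M bounded_clinearD[OF bounded_clinear_creation])
  then have "orth_proj M (creation i ?w) = orth_proj M (creation i (orth_proj M ?w))"
    by (simp add: bounded_clinearD[OF bounded_clinear_orth_proj[OF M]])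
  moreover have "compression M (creation i) (orth_proj M ?w) = orth_proj M (creation i (orth_proj M ?w))"
    by (simp add: compression_def orth_proj_in M)
  ultimately show ?case
    by (simp add: word_op_simps Cons)
qed

text \<open>The bounded projection passes through the series and the radial limit, so the calculus
  yields the compression of \<open>\<phi>\<close>. Uniqueness of limits gives the converse
  direction.\<close>

lemma has_fcalculus_compression_iff:
  assumes M: "closed_csubspace M" and inv: "\<And>i. cadjoint (creation i) ` M \<subseteq> M" and \<phi>: "\<phi> \<in> F_infty"
  shows "has_fcalculus \<phi> M (\<lambda>i. compression M (creation i)) X \<longleftrightarrow> (\<forall>h\<in>M. X h = orth_proj M (\<phi> h))"
proof -
  note P = bounded_clinear_orth_proj[OF M]
  let ?s = "\<lambda>h r. \<Sum>k. \<Sum>\<alpha> | length \<alpha> = k. (complex_of_real (r ^ length \<alpha>) * coord (\<phi> (ket [])) \<alpha>) *\<^sub>C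
      word_op (\<lambda>i. compression M (creation i)) \<alpha> h"
  have "(?s h \<longlongrightarrow> orth_proj M (\<phi> h)) (at_left 1)" if h: "h \<in> M" for h
  proof -
    have "\<forall>\<^sub>F r in at_left 1. orth_proj M (toeplitz (\<phi> (ket [])) r h) = ?s h r"
      using eventually_at_left_1
    proof eventually_elim
      case (elim r)
      have "orth_proj M (toeplitz (\<phi> (ket [])) r h) = (\<Sum>k. orth_proj M (toeplitz_term (\<phi> (ket [])) r h k))"
        unfolding toeplitz_def using elim
        by (intro bounded_linear.suminf[OF bounded_clinearD(1)[OF P]] summable_toeplitz_term) auto
      also have "\<dots> = ?s h r"
        by (simp add: toeplitz_term_def linear_sum[OF bounded_linear.linear[OF bounded_clinearD(1)[OF P]]]
            bounded_clinearD(2)[OF P] word_op_compression[OF M inv h])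
      finally show ?case .
    qed
    moreover have "((\<lambda>r. orth_proj M (toeplitz (\<phi> (ket [])) r h)) \<longlongrightarrow> orth_proj M (\<phi> h)) (at_left 1)"
      by (intro bounded_linear.tendsto[OF bounded_clinearD(1)[OF P]] tendsto_toeplitz \<phi>)
    ultimately show ?thesis by (simp add: tendsto_cong)
  qed
  then show ?thesis
    unfolding has_fcalculus_def
    by (metis (no_types, lifting) tendsto_unique trivial_limit_at_left_real)
qed

section \<open>Constrained subspaces\<close>

lemma N_space_eq: "N_space J = orth_compl (\<Union>\<phi>\<in>J. range \<phi>)"
  by (simp add: N_space_def orth_compl_closed_cspan)

lemma N_space_in_constrained_subspaces:
  assumes J: "two_sided_ideal F_infty J"
  shows "N_space J \<in> constrained_subspaces J creation"
proof -
  have N: "closed_csubspace (N_space J)"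
    by (simp add: N_space_def closed_csubspace_orth_compl)
  have JF: "J \<subseteq> F_infty" using J by (simp add: two_sided_ideal_def)
  have inv: "cadjoint (creation i) ` N_space J \<subseteq> N_space J" for i
  proof
    fix z assume "z \<in> cadjoint (creation i) ` N_space J"
    then obtain x where x: "x \<in> N_space J" "z = cadjoint (creation i) x" by blast
    have "cinner z (\<phi> y) = 0" if "\<phi> \<in> J" for \<phi> y
    proof -
      \<comment> \<open>Pairing \<open>cadjoint (creation i) x\<close> with \<open>\<phi> y\<close>
        amounts to pairing \<open>x\<close> with a value of
        \<open>creation i \<circ> \<phi>\<close>; the left ideal property keeps this operator in
        \<open>J\<close>.\<close>
      have "creation i \<circ> \<phi> \<in> J"
        using J that creation_in_F_infty[of i] by (auto simp: two_sided_ideal_def simp del: o_apply)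
      then have "creation i (\<phi> y) \<in> (\<Union>\<phi>\<in>J. range \<phi>)"
        by (metis UN_I comp_apply rangeI)
      then have "cinner x (creation i (\<phi> y)) = 0"
        using x(1) unfolding N_space_eq orth_compl_def by blast
      then have "cinner (creation i (\<phi> y)) x = 0"
        using cinner_commute[of "creation i (\<phi> y)" x] by simp
      then show ?thesis
        unfolding cinner_creation x(2) using cinner_commute by (metis complex_cnj_zero)
    qed
    then show "z \<in> N_space J" by (auto simp: N_space_eq orth_compl_def)
  qed
  have "orth_proj (N_space J) (\<phi> h) = 0" if "\<phi> \<in> J" for \<phi> h
  proof -
    have "cinner (\<phi> h) y = 0" if "y \<in> N_space J" for y
      using that \<open>\<phi> \<in> J\<close> cinner_commute[of "\<phi> h" y] by (auto simp: N_space_eq orth_compl_def)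
    then have "\<phi> h \<in> orth_compl (N_space J)"
      by (simp add: orth_compl_def)
    then show ?thesis by (simp add: orth_proj_eq_0_iff N)
  qed
  then show ?thesis
    using JF inv by (auto simp: constrained_subspaces_def N has_fcalculus_compression_iff)
qed

lemma constrained_subspaces_subset_N_space:
  assumes J: "J \<subseteq> F_infty" and M: "M \<in> constrained_subspaces J creation"
  shows "M \<subseteq> N_space J"
proof
  fix x assume x: "x \<in> M"
  have cl: "closed_csubspace M" and inv: "\<And>i. cadjoint (creation i) ` M \<subseteq> M"
    using M by (auto simp: constrained_subspaces_def)
  have "cinner x (\<phi> y) = 0" if \<phi>: "\<phi> \<in> J" for \<phi> y
  proof -
    \<comment> \<open>The vector \<open>y\<close> is split along \<open>M\<close>: the constraint
      sends \<open>?p\<close> into the complement of \<open>M\<close>, and invariance of the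
      complement handles \<open>y - ?p\<close>.\<close>
    let ?p = "orth_proj M y"
    have \<phi>F: "\<phi> \<in> F_infty" using J \<phi> by blast
    have "orth_proj M (\<phi> ?p) = 0"
      using M \<phi> orth_proj_in[OF cl, of y]
      by (auto simp: constrained_subspaces_def has_fcalculus_compression_iff[OF cl inv \<phi>F])
    then have "\<phi> ?p \<in> orth_compl M"
      by (simp add: orth_proj_eq_0_iff cl)
    moreover have "\<phi> (y - ?p) \<in> orth_compl M"
      by (rule F_infty_orth_compl[OF inv \<phi>F diff_orth_proj[OF cl]])
    ultimately have "\<phi> ?p + \<phi> (y - ?p) \<in> orth_compl M"
      by (rule closed_csubspaceD(3)[OF closed_csubspace_orth_compl])
    then have "\<phi> y \<in> orth_compl M"
      by (simp add: bounded_clinearD[OF F_infty_commutes_right_creation(1)[OF \<phi>F]])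
    then show ?thesis
      using x cinner_commute[of x "\<phi> y"] by (simp add: orth_compl_def)
  qed
  then show "x \<in> N_space J" by (auto simp: N_space_eq orth_compl_def)
qed

theorem proposition2p9:
  fixes J :: "('n::finite fock \<Rightarrow> 'n fock) set"
    and B :: "'n \<Rightarrow> 'n fock \<Rightarrow> 'n fock"
  assumes "two_sided_ideal F_infty J" and "closedin wot J" and "J \<noteq> F_infty"
    and "\<And>i. B i = compression (N_space J) (creation i)"
  shows "is_max_constrained_piece J creation (N_space J) B"
proof -
  have J: "J \<subseteq> F_infty" using assms(1) by (simp add: two_sided_ideal_def)
  \<comment> \<open>\<open>N_space J\<close> is itself one of the spanning subspaces and, being
    closed, absorbs the closed span of all of them.\<close>
  have "N_space J = max_constrained_space J creation"
  proof
    show "N_space J \<subseteq> max_constrained_space J creation"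
      unfolding max_constrained_space_def closed_cspan_def
      by (rule order_trans[OF Union_upper[OF N_space_in_constrained_subspaces[OF assms(1)]] hull_subset])
    show "max_constrained_space J creation \<subseteq> N_space J"
      unfolding max_constrained_space_def closed_cspan_def
      using constrained_subspaces_subset_N_space[OF J]
      by (intro hull_minimal) (auto simp: N_space_def closed_csubspace_orth_compl)
  qed
  then show ?thesis
    using J assms(4)
    by (auto simp: is_max_constrained_piece_def row_contraction_creation completely_non_coisometric_creation)
qed

end
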